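(* Let $\phi:[0,1]\to[0,1]$ be concave with $\phi(0)=0$, $\phi(1)=1$. Then all ri function norms $R$ with fundamental function $\phi$ coincide on $\mathcal{M}^+$, and moreover $\|X\|_{M_\phi}=R(X)=\|X\|_{\Lambda_\phi}$ for all $X\in\mathcal{M}^+$, if and only if either $\phi(t)=\min\{t/(1-\alpha),1\}$ for some $\alpha\in[0,1)$, in which case all these equal $\operatorname{CVar}_\alpha(X)=\frac{1}{1-\alpha}\int_0^{1-\alpha}X^*(\omega)\,d\omega$, or $\phi=\chi_{(0,1]}$ (the limit $\alpha\to1$), in which case all these equal $\|X\|_{\mathcal{L}^\infty}=\operatorname{ess\,sup} X$.
   Context: $\Omega=[0,1]$ with Lebesgue measure $\mu$; $\mathcal{M}$ measurable functions, $\mathcal{M}^+$ those with values in $[0,\infty]$. A Banach function norm is $R:\mathcal{M}^+\to[0,\infty]$ with: $R(X)=0\iff X=0$, positive homogeneity, subadditivity; monotonicity $0\le X\le Y\Rightarrow R(X)\le R(Y)$; Fatou property $0\le X_n\uparrow X$ a.e. $\Rightarrow R(X_n)\uparrow R(X)$; $R(\chi_E)<\infty$ and $\int_E X\,d\mu\le c_E R(X)$ for a constant $c_E$ depending only on $E,R$; normalised $R(\chi_\Omega)=1$. It is an ri function norm if $R(X)=R(Y)$ for equimeasurable $X,Y$ (same distribution function $\lambda\mapsto\mu\{|X|>\lambda\}$). Decreasing rearrangement: $X^*(\omega)=\inf\{\lambda\ge0:\mu\{|X|>\lambda\}\le\omega\}$, $X^*(0)=\operatorname{ess\,sup}|X|$.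 Fundamental function: $\phi_R(t)=R(\chi_E)$, $\mu(E)=t$. Lorentz norm: $\|X\|_{\Lambda_\phi}=X^*(0)\phi(0+)+\int_0^1X^*(\omega)\phi'(\omega)\,d\omega$. Marcinkiewicz norm: $\|X\|_{M_\phi}=\sup_{0<t\le1}\frac{\phi(t)}{t}\int_0^tX^*(\omega)\,d\omega$. Both are ri norms with fundamental function $\phi$. *)

theory Defs
  imports "HOL-Analysis.Analysis" "HOL-Probability.Essential_Supremum"
begin

definition Omega :: "real measure" where
  "Omega = lebesgue_on {0..1}"

definition equimeasurable :: "(real \<Rightarrow> ennreal) \<Rightarrow> (real \<Rightarrow> ennreal) \<Rightarrow> bool" where
  "equimeasurable X Y \<longleftrightarrow>
     (\<forall>l::real. l \<ge> 0 \<longrightarrow>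
        emeasure Omega {\<omega> \<in> space Omega. ennreal l < X \<omega>}
        = emeasure Omega {\<omega> \<in> space Omega. ennreal l < Y \<omega>})"

definition banach_function_norm :: "((real \<Rightarrow> ennreal) \<Rightarrow> ennreal) \<Rightarrow> bool" where
  "banach_function_norm R \<longleftrightarrow>
     (\<forall>X \<in> borel_measurable Omega. R X = 0 \<longleftrightarrow> (AE \<omega> in Omega. X \<omega> = 0)) \<and>
     (\<forall>X \<in> borel_measurable Omega. \<forall>c::real. c \<ge> 0 \<longrightarrow>
        R (\<lambda>\<omega>. ennreal c * X \<omega>) = ennreal c * R X) \<and>
     (\<forall>X \<in> borel_measurable Omega. \<forall>Y \<in> borel_measurable Omega.
        R (\<lambda>\<omega>. X \<omega> + Y \<omega>) \<le> R X + R Y) \<and>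
     (\<forall>X \<in> borel_measurable Omega. \<forall>Y \<in> borel_measurable Omega.
        (AE \<omega> in Omega. X \<omega> \<le> Y \<omega>) \<longrightarrow> R X \<le> R Y) \<and>
     (\<forall>Xn X. (\<forall>n. Xn n \<in> borel_measurable Omega) \<longrightarrow> X \<in> borel_measurable Omega \<longrightarrow>
        (AE \<omega> in Omega. incseq (\<lambda>n. Xn n \<omega>) \<and> (\<lambda>n. Xn n \<omega>) \<longlonglongrightarrow> X \<omega>) \<longrightarrow>
        (\<lambda>n. R (Xn n)) \<longlonglongrightarrow> R X) \<and>
     (\<forall>E \<in> sets Omega. R (indicator E) < \<infinity> \<and>
        (\<exists>c::real. \<forall>X \<in> borel_measurable Omega.
           (\<integral>\<^sup>+ \<omega>\<in>E. X \<omega> \<partial>Omega) \<le> ennreal c * R X)) \<and>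
     R (indicator (space Omega)) = 1"

definition ri_function_norm :: "((real \<Rightarrow> ennreal) \<Rightarrow> ennreal) \<Rightarrow> bool" where
  "ri_function_norm R \<longleftrightarrow> banach_function_norm R \<and>
     (\<forall>X \<in> borel_measurable Omega. \<forall>Y \<in> borel_measurable Omega.
        equimeasurable X Y \<longrightarrow> R X = R Y)"

definition has_fundamental_function ::
  "((real \<Rightarrow> ennreal) \<Rightarrow> ennreal) \<Rightarrow> (real \<Rightarrow> real) \<Rightarrow> bool" where
  "has_fundamental_function R \<phi> \<longleftrightarrow>
     (\<forall>E \<in> sets Omega. R (indicator E) = ennreal (\<phi> (measure Omega E)))"

text \<open>Decreasing rearrangement X*(w) = inf{l >= 0. mu{X > l} <= w};
  at w = 0 this is the essential supremum.\<close>
definition decr_rearr :: "(real \<Rightarrow> ennreal) \<Rightarrow> real \<Rightarrow> ennreal" where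
  "decr_rearr X \<omega> =
     Inf {l::ennreal. emeasure Omega {x \<in> space Omega. l < X x} \<le> ennreal \<omega>}"

definition lorentz_norm :: "(real \<Rightarrow> real) \<Rightarrow> (real \<Rightarrow> ennreal) \<Rightarrow> ennreal" where
  "lorentz_norm \<phi> X =
     decr_rearr X 0 * ennreal (Lim (at_right 0) \<phi>) +
     (\<integral>\<^sup>+ \<omega>\<in>{0..1}. decr_rearr X \<omega> * ennreal (deriv \<phi> \<omega>) \<partial>lebesgue)"

definition marcinkiewicz_norm :: "(real \<Rightarrow> real) \<Rightarrow> (real \<Rightarrow> ennreal) \<Rightarrow> ennreal" where
  "marcinkiewicz_norm \<phi> X =
     (SUP t\<in>{0<..1}. ennreal (\<phi> t / t) * (\<integral>\<^sup>+ \<omega>\<in>{0..t}. decr_rearr X \<omega> \<partial>lebesgue))"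

definition CVar :: "real \<Rightarrow> (real \<Rightarrow> ennreal) \<Rightarrow> ennreal" where
  "CVar \<alpha> X = ennreal (1 / (1 - \<alpha>)) * (\<integral>\<^sup>+ \<omega>\<in>{0..1-\<alpha>}. decr_rearr X \<omega> \<partial>lebesgue)"

end

theory Submission
  imports Defs "HOL-Probability.Probability_Measure"
begin

text \<open>
  If all norms coincide, then in particular the Marcinkiewicz norm, which is itself an ri norm with
  fundamental function \<open>\<phi>\<close>, equals the Lorentz norm. The latter is additive on the
  comonotone pair \<open>\<chi>\<^bsub>[0,s]\<^esub>\<close>, \<open>1\<close>, so the supremum over \<open>t\<close> of
  \<open>\<phi>(t)/t (min t s + t)\<close> is at least \<open>\<phi>(s) + 1\<close>. As \<open>\<phi>(t)/t\<close> decreases and \<open>\<phi>\<close> increases,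
  this forces \<open>\<phi>\<close> to reach 1 at \<open>s/\<phi>(s)\<close> whenever \<open>\<phi>(s) < 1\<close>; hence \<open>\<phi>(s)/s\<close> does not depend on \<open>s\<close>
  as long as \<open>\<phi>(s) < 1\<close>.

  Conversely let \<open>\<phi>(t) = min (t/b) 1\<close>. Since \<open>\<phi>(t) \<le> t/b\<close>, we have \<open>R(Z) \<le> 1/b \<integral>Z\<close>, and
  \<open>X \<le> l + (X - l)\<^sup>+\<close> with \<open>l = X*(b)\<close> gives \<open>R(X) \<le> 1/b \<integral>\<^sub>0\<^sup>b X*\<close>. For the other
  inequality, average the cyclic shifts of a lower step function of \<open>X*\<close> on \<open>[0,b)\<close>: all shifts have
  the same norm, and their mean is a constant times \<open>\<chi>\<^bsub>[0,b)\<^esub>\<close>, which has norm \<open>\<phi>(b) = 1\<close>.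
\<close>

subsection \<open>Distribution functions and decreasing rearrangements\<close>

lemma space_Omega: "space Omega = {0..1}"
  by (simp add: Omega_def)

lemma sets_OmegaD: "A \<in> sets Omega \<Longrightarrow> A \<in> sets lebesgue \<and> A \<subseteq> {0..1}"
  by (auto simp: Omega_def sets_restrict_space_iff)

lemma sets_OmegaI: "A \<in> sets lebesgue \<Longrightarrow> A \<subseteq> {0..1} \<Longrightarrow> A \<in> sets Omega"
  by (auto simp: Omega_def sets_restrict_space_iff)

lemma emeasure_Omega: "A \<subseteq> {0..1} \<Longrightarrow> emeasure Omega A = emeasure lebesgue A"
  by (simp add: Omega_def emeasure_restrict_space)

lemma prob_space_Omega: "prob_space Omega"
  by (rule prob_spaceI) (simp add: space_Omega emeasure_Omega)

interpretation Omega: prob_space Omega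
  by (rule prob_space_Omega)

lemma nn_integral_Omega: "integral\<^sup>N Omega f = (\<integral>\<^sup>+\<omega>\<in>{0..1}. f \<omega> \<partial>lebesgue)"
  by (simp add: Omega_def nn_integral_restrict_space)

lemma measurable_Omega: "f \<in> borel_measurable lebesgue \<Longrightarrow> f \<in> borel_measurable Omega"
  by (simp add: Omega_def measurable_restrict_space1)

text \<open>Superlevel sets of a rearrangement turn out to have this form, which is what makes X*
  equimeasurable with X.\<close>

lemma emeasure_Omega_below:
  assumes "c \<le> 1"
  shows "emeasure Omega {x \<in> space Omega. ennreal x < c} = c"
proof -
  obtain r where r: "0 \<le> r" "c = ennreal r" "r \<le> 1"
    using assms by (cases c) (auto simp: top_unique)
  have "{x \<in> space Omega. ennreal x < c} = {0..<r}"
    using r by (auto simp: space_Omega ennreal_less_iff)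
  moreover have "{0..<r} \<subseteq> {0..1}"
    using r by auto
  ultimately show ?thesis
    using r by (simp add: emeasure_Omega)
qed

abbreviation distr_fun :: "(real \<Rightarrow> ennreal) \<Rightarrow> ennreal \<Rightarrow> ennreal" where
  "distr_fun X l \<equiv> emeasure Omega {x \<in> space Omega. l < X x}"

lemma distr_fun_antimono:
  assumes [measurable]: "X \<in> borel_measurable Omega" and "l \<le> m"
  shows "distr_fun X m \<le> distr_fun X l"
  using assms(2) by (intro emeasure_mono) auto

lemma distr_fun_mono_AE:
  assumes [measurable]: "X \<in> borel_measurable Omega" "Y \<in> borel_measurable Omega"
    and "AE \<omega> in Omega. X \<omega> \<le> Y \<omega>"
  shows "distr_fun X l \<le> distr_fun Y l"
  using assms(3) by (intro emeasure_mono_AE) (auto elim: less_le_trans)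

text \<open>The sets where X exceeds l + 1/(n+1) increase to the set where X exceeds l, so the
  measure is continuous from below along them. This is why the infimum defining X* is
  attained.\<close>

lemma distr_fun_right_continuous:
  assumes [measurable]: "X \<in> borel_measurable Omega" and c: "c < distr_fun X l"
  obtains m where "l < m" "c < distr_fun X m"
proof -
  have "l \<noteq> top"
    using c by (cases "l = top") auto
  let ?A = "\<lambda>n. {x \<in> space Omega. l + ennreal (1 / real (Suc n)) < X x}"
  have eq: "{x \<in> space Omega. l < X x} = (\<Union>n. ?A n)"
  proof (intro equalityI subsetI)
    fix x assume x: "x \<in> {x \<in> space Omega. l < X x}"
    then have "0 < X x - l"
      by (simp add: diff_gr0_ennreal)
    \<comment> \<open>\<open>X x\<close> may be infinite, so a finite gap is fixed before the
      Archimedean property is used.\<close>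
    then obtain e where e: "0 < e" "e < X x - l"
      using dense by blast
    then have "e < top"
      using top_greatest less_le_trans by blast
    then obtain r where r: "0 < r" "e = ennreal r"
      using e by (cases e) auto
    obtain n where n: "1 / real (Suc n) < r"
      using r(1) nat_approx_posE by metis
    have "ennreal (1 / real (Suc n)) \<le> e"
      using n r by (simp add: ennreal_leI)
    then have "l + ennreal (1 / real (Suc n)) \<le> l + e"
      by (rule add_left_mono)
    also have "\<dots> < l + (X x - l)"
      using e \<open>l \<noteq> top\<close> by (simp add: ennreal_add_left_cancel_less)
    also have "\<dots> = X x"
      using x by (simp add: add_diff_inverse_ennreal less_imp_le)
    finally show "x \<in> (\<Union>n. ?A n)"
      using x by auto
  next
    fix x assume "x \<in> (\<Union>n. ?A n)"
    then obtain n where x: "x \<in> space Omega" "l + ennreal (1 / real (Suc n)) < X x"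
      by auto
    have "l \<le> l + ennreal (1 / real (Suc n))"
      by simp
    also have "\<dots> < X x"
      by (fact x)
    finally show "x \<in> {x \<in> space Omega. l < X x}"
      using x by simp
  qed
  have "incseq ?A"
  proof (rule incseq_SucI, safe)
    fix n x assume *: "l + ennreal (1 / real (Suc n)) < X x"
    have "l + ennreal (1 / real (Suc (Suc n))) \<le> l + ennreal (1 / real (Suc n))"
      by (intro add_left_mono ennreal_leI) (simp add: field_simps)
    then show "l + ennreal (1 / real (Suc (Suc n))) < X x"
      using * by (rule le_less_trans)
  qed
  then have "(SUP n. emeasure Omega (?A n)) = distr_fun X l"
    unfolding eq by (intro SUP_emeasure_incseq) auto
  with c have "c < (SUP n. emeasure Omega (?A n))"
    by (simp only:)
  then obtain n where "c < emeasure Omega (?A n)"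
    unfolding less_SUP_iff by blast
  moreover have "l < l + ennreal (1 / real (Suc n))"
    using \<open>l \<noteq> top\<close> by (simp add: ennreal_add_left_cancel_less[of l 0, simplified] less_top)
  ultimately show ?thesis
    using that by blast
qed

text \<open>X* is the generalised inverse of the distribution function; right continuity supplies
  the strict inequality on the way back. For negative \<omega> the term
  \<open>ennreal \<omega>\<close> is 0, so the formula covers the whole real line.\<close>

lemma less_decr_rearr_iff:
  assumes X: "X \<in> borel_measurable Omega"
  shows "l < decr_rearr X \<omega> \<longleftrightarrow> ennreal \<omega> < distr_fun X l"
proof
  show "ennreal \<omega> < distr_fun X l" if "l < decr_rearr X \<omega>"
  proof (rule ccontr)
    assume "\<not> ennreal \<omega> < distr_fun X l"
    then have "decr_rearr X \<omega> \<le> l"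
      unfolding decr_rearr_def by (intro Inf_lower) auto
    then show False
      using that by auto
  qed
next
  assume "ennreal \<omega> < distr_fun X l"
  then obtain m where m: "l < m" "ennreal \<omega> < distr_fun X m"
    using distr_fun_right_continuous[OF X] by blast
  have "m \<le> decr_rearr X \<omega>"
    unfolding decr_rearr_def
  proof (rule Inf_greatest)
    fix k assume k: "k \<in> {l. distr_fun X l \<le> ennreal \<omega>}"
    show "m \<le> k"
    proof (rule ccontr)
      assume "\<not> m \<le> k"
      then have "distr_fun X m \<le> distr_fun X k"
        using distr_fun_antimono[OF X, of k m] by auto
      then show False
        using k m by auto
    qed
  qed
  then show "l < decr_rearr X \<omega>"
    using m by auto
qed

lemma decr_rearr_le_iff:
  assumes "X \<in> borel_measurable Omega"
  shows "decr_rearr X \<omega> \<le> l \<longleftrightarrow> distr_fun X l \<le> ennreal \<omega>"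
  using less_decr_rearr_iff[OF assms, of l \<omega>] by (simp add: not_less[symmetric])

lemma decr_rearr_antimono: "\<omega> \<le> \<omega>' \<Longrightarrow> decr_rearr X \<omega>' \<le> decr_rearr X \<omega>"
  unfolding decr_rearr_def by (intro Inf_superset_mono) (auto intro: order_trans ennreal_leI)

lemma decr_rearr_measurable:
  assumes X: "X \<in> borel_measurable Omega"
  shows "decr_rearr X \<in> borel_measurable borel"
proof (rule borel_measurableI_greater)
  fix l
  have "{\<omega> \<in> space borel. l < decr_rearr X \<omega>} = {\<omega> \<in> space borel. ennreal \<omega> < distr_fun X l}"
    using less_decr_rearr_iff[OF X] by auto
  also have "\<dots> \<in> sets borel"
    by measurable
  finally show "{\<omega> \<in> space borel. l < decr_rearr X \<omega>} \<in> sets borel" .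
qed

lemma decr_rearr_measurable_lebesgue [measurable]:
  "X \<in> borel_measurable Omega \<Longrightarrow> decr_rearr X \<in> borel_measurable lebesgue"
  by (rule measurable_completion) (simp add: decr_rearr_measurable)

lemma decr_rearr_measurable_Omega [measurable]:
  "X \<in> borel_measurable Omega \<Longrightarrow> decr_rearr X \<in> borel_measurable Omega"
  by (simp add: measurable_Omega)

lemma distr_fun_decr_rearr:
  assumes "X \<in> borel_measurable Omega"
  shows "distr_fun (decr_rearr X) l = distr_fun X l"
  using emeasure_Omega_below[OF Omega.emeasure_le_1]
  by (simp add: less_decr_rearr_iff[OF assms])

lemma equimeasurable_decr_rearr:
  "X \<in> borel_measurable Omega \<Longrightarrow> equimeasurable X (decr_rearr X)"
  by (simp add: equimeasurable_def distr_fun_decr_rearr)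

text \<open>The definition tests only finite levels; at the remaining level \<open>top\<close> both
  superlevel sets are empty.\<close>

lemma equimeasurable_distr_fun:
  assumes "equimeasurable X Y"
  shows "distr_fun X l = distr_fun Y l"
proof (cases l)
  case (real r)
  then show ?thesis
    using assms by (auto simp: equimeasurable_def)
qed simp

text \<open>Open upper rays form an intersection-stable generator of the Borel sets. Each of them
  misses 0, so \<open>UNIV\<close> is added to provide the exhausting sequence that the uniqueness
  theorem for measures asks for.\<close>

lemma equimeasurable_distr_eq:
  assumes [measurable]: "X \<in> borel_measurable Omega" "Y \<in> borel_measurable Omega"
    and XY: "equimeasurable X Y"
  shows "distr Omega borel X = distr Omega borel Y"
proof (rule measure_eqI_generator_eq[where \<Omega> = UNIV
      and E = "insert UNIV (range greaterThan)" and A = "\<lambda>_. UNIV"])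
  show "Int_stable (insert UNIV (range (greaterThan :: ennreal \<Rightarrow> _)))"
  proof (rule Int_stableI)
    fix a b :: "ennreal set"
    have "{x<..} \<inter> {y<..} = {max x y<..}" for x y :: ennreal
      by auto
    then show "a \<in> insert UNIV (range greaterThan) \<Longrightarrow> b \<in> insert UNIV (range greaterThan) \<Longrightarrow>
        a \<inter> b \<in> insert UNIV (range greaterThan)"
      by auto
  qed
next
  fix B :: "ennreal set"
  assume "B \<in> insert UNIV (range greaterThan)"
  then consider "B = UNIV" | l where "B = {l<..}"
    by auto
  then show "emeasure (distr Omega borel X) B = emeasure (distr Omega borel Y) B"
  proof cases
    case 1
    then show ?thesis
      by (simp add: emeasure_distr)
  next
    case 2
    then have "Z -` B \<inter> space Omega = {x \<in> space Omega. l < Z x}" for Z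
      by auto
    then show ?thesis
      using equimeasurable_distr_fun[OF XY, of l] 2 by (simp add: emeasure_distr)
  qed
next
  have "sets (borel :: ennreal measure) = sigma_sets UNIV (insert UNIV (range greaterThan))"
  proof -
    have "sigma_sets UNIV (insert UNIV (range greaterThan))
        = sigma_sets UNIV (range (greaterThan :: ennreal \<Rightarrow> _))"
      by (rule sigma_sets_eqI) (auto intro: sigma_sets_top)
    then show ?thesis
      by (subst borel_Ioi) simp
  qed
  then show "sets (distr Omega borel X) = sigma_sets UNIV (insert UNIV (range greaterThan))"
    and "sets (distr Omega borel Y) = sigma_sets UNIV (insert UNIV (range greaterThan))"
    by simp_all
next
  show "emeasure (distr Omega borel X) UNIV \<noteq> \<infinity>" for i :: nat
    by (simp add: emeasure_distr)
qed auto

lemma equimeasurable_nn_integral: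
  assumes [measurable]: "X \<in> borel_measurable Omega" "Y \<in> borel_measurable Omega"
    and "equimeasurable X Y" and [measurable]: "h \<in> borel_measurable borel"
  shows "(\<integral>\<^sup>+\<omega>. h (X \<omega>) \<partial>Omega) = (\<integral>\<^sup>+\<omega>. h (Y \<omega>) \<partial>Omega)"
proof -
  have "(\<integral>\<^sup>+\<omega>. h (X \<omega>) \<partial>Omega) = integral\<^sup>N (distr Omega borel X) h"
    by (simp add: nn_integral_distr)
  also have "\<dots> = (\<integral>\<^sup>+\<omega>. h (Y \<omega>) \<partial>Omega)"
    by (simp add: equimeasurable_distr_eq[OF assms(1,2,3)] nn_integral_distr)
  finally show ?thesis .
qed

lemma decr_rearr_cong: "equimeasurable X Y \<Longrightarrow> decr_rearr X = decr_rearr Y"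
  using equimeasurable_distr_fun[of X Y] by (simp add: decr_rearr_def fun_eq_iff)

lemma decr_rearr_mono:
  assumes "X \<in> borel_measurable Omega" "Y \<in> borel_measurable Omega"
    and "AE \<omega> in Omega. X \<omega> \<le> Y \<omega>"
  shows "decr_rearr X \<omega> \<le> decr_rearr Y \<omega>"
  unfolding decr_rearr_def using distr_fun_mono_AE[OF assms]
  by (intro Inf_superset_mono) (auto intro: order_trans)

lemma eq_if_less_iff:
  fixes x y :: "'a::linorder"
  assumes "\<And>l. l < x \<longleftrightarrow> l < y"
  shows "x = y"
  using assms[of x] assms[of y] by auto

lemma decr_rearr_cmult:
  assumes [measurable]: "X \<in> borel_measurable Omega" and c: "0 < c"
  shows "decr_rearr (\<lambda>\<omega>. ennreal c * X \<omega>) \<omega> = ennreal c * decr_rearr X \<omega>"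
proof -
  have *: "l < ennreal c * x \<longleftrightarrow> l / ennreal c < x" for l x
    using c by (subst divide_less_ennreal) (auto simp: mult.commute)
  have "l < decr_rearr (\<lambda>\<omega>. ennreal c * X \<omega>) \<omega> \<longleftrightarrow> l < ennreal c * decr_rearr X \<omega>" for l
    by (simp add: less_decr_rearr_iff *)
  then show ?thesis
    by (rule eq_if_less_iff)
qed

text \<open>The superlevel set of the indicator is \<open>E\<close> below level 1 and empty from
  there on. At a negative \<omega> and for a null set \<open>E\<close>, X* would be 0 but the right
  side 1.\<close>

lemma decr_rearr_indicator:
  assumes [measurable]: "E \<in> sets Omega" and "0 \<le> \<omega>"
  shows "decr_rearr (indicator E) \<omega> = indicator {..<measure Omega E} \<omega>"
proof -
  have *: "{x \<in> space Omega. l < indicator E x} = (if l < 1 then E else {})" for l :: ennreal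
    using sets.sets_into_space[OF assms(1)] by (auto simp: indicator_def not_less)
  have "l < decr_rearr (indicator E) \<omega> \<longleftrightarrow> l < indicator {..<measure Omega E} \<omega>" for l
    using assms(2) by (simp add: less_decr_rearr_iff * Omega.emeasure_eq_measure ennreal_less_iff
        split: split_indicator)
  then show ?thesis
    by (rule eq_if_less_iff)
qed

text \<open>The distribution function of the limit is at most the supremum of those of the
  \<open>Xn\<close>. At the level sup Xn*(\<omega>) that supremum is at most \<omega>, and inversion
  then bounds X*(\<omega>) by this level.\<close>

lemma decr_rearr_SUP:
  assumes Xn [measurable]: "\<And>n. Xn n \<in> borel_measurable Omega"
    and X [measurable]: "X \<in> borel_measurable Omega"
    and lim: "AE \<omega> in Omega. incseq (\<lambda>n. Xn n \<omega>) \<and> (\<lambda>n. Xn n \<omega>) \<longlonglongrightarrow> X \<omega>"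
  shows "incseq (\<lambda>n. decr_rearr (Xn n) \<omega>)" "(SUP n. decr_rearr (Xn n) \<omega>) = decr_rearr X \<omega>"
proof -
  show "incseq (\<lambda>n. decr_rearr (Xn n) \<omega>)"
    using lim by (intro incseq_SucI decr_rearr_mono) (auto simp: incseq_Suc_iff)
  have le: "AE \<omega> in Omega. Xn n \<omega> \<le> X \<omega>" for n
    using lim by eventually_elim (auto intro: incseq_le)
  have D: "distr_fun X l \<le> (SUP n. distr_fun (Xn n) l)" for l
  proof -
    \<comment> \<open>Asking for all m \<ge> n makes these sets increase in n, and convergence puts
      almost every point with l < X into one of them.\<close>
    have "AE \<omega> in Omega. l < X \<omega> \<longrightarrow> \<omega> \<in> (\<Union>n. {\<omega> \<in> space Omega. \<forall>m\<ge>n. l < Xn m \<omega>})"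
      using lim AE_space
    proof eventually_elim
      case (elim \<omega>)
      then show ?case
        by (auto dest: order_tendstoD(1) simp: eventually_sequentially)
    qed
    then have "distr_fun X l \<le> emeasure Omega (\<Union>n. {\<omega> \<in> space Omega. \<forall>m\<ge>n. l < Xn m \<omega>})"
      by (intro emeasure_mono_AE) auto
    also have "\<dots> = (SUP n. emeasure Omega {\<omega> \<in> space Omega. \<forall>m\<ge>n. l < Xn m \<omega>})"
      by (intro SUP_emeasure_incseq[symmetric]) (auto simp: incseq_def)
    also have "\<dots> \<le> (SUP n. distr_fun (Xn n) l)"
      by (intro SUP_mono) (auto intro!: emeasure_mono)
    finally show ?thesis .
  qed
  show "(SUP n. decr_rearr (Xn n) \<omega>) = decr_rearr X \<omega>"
  proof (rule antisym)
    show "(SUP n. decr_rearr (Xn n) \<omega>) \<le> decr_rearr X \<omega>"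
      by (intro SUP_least decr_rearr_mono le) auto
    show "decr_rearr X \<omega> \<le> (SUP n. decr_rearr (Xn n) \<omega>)"
      unfolding decr_rearr_le_iff[OF X]
    proof -
      let ?s = "SUP n. decr_rearr (Xn n) \<omega>"
      have "distr_fun (Xn n) ?s \<le> ennreal \<omega>" for n
        by (subst decr_rearr_le_iff[symmetric]) (auto intro: SUP_upper)
      then have "(SUP n. distr_fun (Xn n) ?s) \<le> ennreal \<omega>"
        by (rule SUP_least)
      with D[of ?s] show "distr_fun X ?s \<le> ennreal \<omega>"
        by (rule order_trans)
    qed
  qed
qed

subsection \<open>The Marcinkiewicz norm\<close>

lemma atLeastAtMost_lebesgue [measurable]: "{a..b::real} \<in> sets lebesgue"
  by simp

lemma atLeastLessThan_lebesgue [measurable]: "{a..<b::real} \<in> sets lebesgue"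
  by simp

section \<open>Integrals of the rearrangement over initial intervals\<close>

lemma nn_integral_decr_rearr:
  assumes [measurable]: "X \<in> borel_measurable Omega" "h \<in> borel_measurable borel"
  shows "(\<integral>\<^sup>+\<omega>. h (X \<omega>) \<partial>Omega) = (\<integral>\<^sup>+\<omega>\<in>{0..1}. h (decr_rearr X \<omega>) \<partial>lebesgue)"
  using equimeasurable_nn_integral[OF assms(1) _ equimeasurable_decr_rearr[OF assms(1)] assms(2)]
  by (simp add: nn_integral_Omega)

lemma ennreal_le_add_diff: "x \<le> y + (x - y)" for x y :: ennreal
  by (cases "y \<le> x") (auto simp: add_diff_inverse_ennreal intro: add_increasing2)

text \<open>One half of the formula that the integral of X* over [0,t] is the minimum over l of l t
  plus the integral of the positive part of X - l. Subtraction in \<open>ennreal\<close> is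
  truncated, so \<open>X \<omega> - l\<close> is that positive part.\<close>

lemma nn_integral_decr_rearr_le:
  assumes [measurable]: "X \<in> borel_measurable Omega" and t: "0 \<le> t" "t \<le> 1"
  shows "(\<integral>\<^sup>+\<omega>\<in>{0..t}. decr_rearr X \<omega> \<partial>lebesgue) \<le> l * ennreal t + (\<integral>\<^sup>+\<omega>. X \<omega> - l \<partial>Omega)"
proof -
  have "(\<integral>\<^sup>+\<omega>\<in>{0..t}. decr_rearr X \<omega> \<partial>lebesgue)
      \<le> (\<integral>\<^sup>+\<omega>. l * indicator {0..t} \<omega> + (decr_rearr X \<omega> - l) * indicator {0..1} \<omega> \<partial>lebesgue)"
    using t by (intro nn_integral_mono) (auto simp: ennreal_le_add_diff split: split_indicator)
  also have "\<dots> = l * ennreal t + (\<integral>\<^sup>+\<omega>\<in>{0..1}. (decr_rearr X \<omega> - l) \<partial>lebesgue)"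
    using t by (subst nn_integral_add) (auto simp: nn_integral_cmult_indicator)
  also have "(\<integral>\<^sup>+\<omega>\<in>{0..1}. (decr_rearr X \<omega> - l) \<partial>lebesgue) = (\<integral>\<^sup>+\<omega>. X \<omega> - l \<partial>Omega)"
    by (rule nn_integral_decr_rearr[symmetric]) auto
  finally show ?thesis .
qed

text \<open>The minimising level is X*(t): up to t the truncation is inactive, and beyond t it gives
  0.\<close>

lemma nn_integral_decr_rearr_eq:
  assumes [measurable]: "X \<in> borel_measurable Omega" and t: "0 < t" "t \<le> 1"
  shows "(\<integral>\<^sup>+\<omega>\<in>{0..t}. decr_rearr X \<omega> \<partial>lebesgue)
    = decr_rearr X t * ennreal t + (\<integral>\<^sup>+\<omega>. X \<omega> - decr_rearr X t \<partial>Omega)"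
proof (rule antisym)
  let ?l = "decr_rearr X t"
  show "?l * ennreal t + (\<integral>\<^sup>+\<omega>. X \<omega> - ?l \<partial>Omega) \<le> (\<integral>\<^sup>+\<omega>\<in>{0..t}. decr_rearr X \<omega> \<partial>lebesgue)"
  proof (cases "?l = top")
    \<comment> \<open>An infinite level is treated apart, since \<open>top - top = top\<close> would
      break the pointwise identity of the other case. Here X* is infinite on all of [0,t].\<close>
    case True
    have "top * emeasure lebesgue {0..t} = (\<integral>\<^sup>+\<omega>. top * indicator {0..t} \<omega> \<partial>lebesgue)"
      by (rule nn_integral_cmult_indicator[symmetric]) measurable
    also have "\<dots> \<le> (\<integral>\<^sup>+\<omega>\<in>{0..t}. decr_rearr X \<omega> \<partial>lebesgue)"
      using True decr_rearr_antimono[of _ t X]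
      by (intro nn_integral_mono) (auto simp: top_unique split: split_indicator)
    finally show ?thesis
      using t by (simp add: ennreal_top_mult top_unique)
  next
    case False
    have *: "?l * indicator {0..t} \<omega> + (decr_rearr X \<omega> - ?l) * indicator {0..1} \<omega>
        = decr_rearr X \<omega> * indicator {0..t} \<omega>" for \<omega>
    proof (cases "\<omega> \<le> t")
      case True
      then show ?thesis
        using t decr_rearr_antimono[of \<omega> t X]
        by (auto simp: add_diff_inverse_ennreal split: split_indicator)
    next
      case False
      then show ?thesis
        using t \<open>?l \<noteq> top\<close> decr_rearr_antimono[of t \<omega> X]
        by (auto simp: diff_eq_0_iff_ennreal less_top top_unique split: split_indicator)
    qed
    have "?l * ennreal t + (\<integral>\<^sup>+\<omega>. X \<omega> - ?l \<partial>Omega)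
        = ?l * ennreal t + (\<integral>\<^sup>+\<omega>\<in>{0..1}. (decr_rearr X \<omega> - ?l) \<partial>lebesgue)"
      by (subst nn_integral_decr_rearr) auto
    also have "\<dots> = (\<integral>\<^sup>+\<omega>. ?l * indicator {0..t} \<omega> + (decr_rearr X \<omega> - ?l) * indicator {0..1} \<omega> \<partial>lebesgue)"
      using t by (subst nn_integral_add) (auto simp: nn_integral_cmult_indicator)
    finally show ?thesis
      unfolding * by simp
  qed
qed (rule nn_integral_decr_rearr_le, use t in auto)

text \<open>This includes the infinite values, as \<^term>\<open>top - top = (top::ennreal)\<close>.\<close>

lemma ennreal_diff_add_le:
  fixes a b c d :: ennreal
  shows "(a + b) - (c + d) \<le> (a - c) + (b - d)"
proof -
  show ?thesis
  proof (cases "c = top \<or> d = top")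
    case True
    then show ?thesis
      by (auto simp: minus_top_ennreal)
  next
    case False
    have "a + b \<le> (c + (a - c)) + (d + (b - d))"
      by (intro add_mono ennreal_le_add_diff)
    then have "a + b \<le> (c + d) + ((a - c) + (b - d))"
      by (simp add: ac_simps)
    then show ?thesis
      using False by (subst ennreal_minus_le_iff) (auto simp: ac_simps)
  qed
qed

text \<open>The level X*(t) + Y*(t) is admissible in the bound for X + Y; splitting the positive
  part leaves the exact values for X and for Y.\<close>

lemma nn_integral_decr_rearr_subadditive:
  assumes [measurable]: "X \<in> borel_measurable Omega" "Y \<in> borel_measurable Omega"
    and t: "0 < t" "t \<le> 1"
  shows "(\<integral>\<^sup>+\<omega>\<in>{0..t}. decr_rearr (\<lambda>\<omega>. X \<omega> + Y \<omega>) \<omega> \<partial>lebesgue)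
    \<le> (\<integral>\<^sup>+\<omega>\<in>{0..t}. decr_rearr X \<omega> \<partial>lebesgue) + (\<integral>\<^sup>+\<omega>\<in>{0..t}. decr_rearr Y \<omega> \<partial>lebesgue)"
proof -
  let ?a = "decr_rearr X t" and ?b = "decr_rearr Y t"
  have "(\<integral>\<^sup>+\<omega>\<in>{0..t}. decr_rearr (\<lambda>\<omega>. X \<omega> + Y \<omega>) \<omega> \<partial>lebesgue)
      \<le> (?a + ?b) * ennreal t + (\<integral>\<^sup>+\<omega>. (X \<omega> + Y \<omega>) - (?a + ?b) \<partial>Omega)"
    using t by (intro nn_integral_decr_rearr_le) auto
  also have "\<dots> \<le> (?a + ?b) * ennreal t + (\<integral>\<^sup>+\<omega>. (X \<omega> - ?a) + (Y \<omega> - ?b) \<partial>Omega)"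
    by (intro add_left_mono nn_integral_mono ennreal_diff_add_le)
  also have "\<dots> = (?a * ennreal t + (\<integral>\<^sup>+\<omega>. X \<omega> - ?a \<partial>Omega)) + (?b * ennreal t + (\<integral>\<^sup>+\<omega>. Y \<omega> - ?b \<partial>Omega))"
    by (subst nn_integral_add) (auto simp: algebra_simps)
  finally show ?thesis
    using t by (simp add: nn_integral_decr_rearr_eq)
qed

lemma nn_integral_decr_rearr_indicator:
  assumes "E \<in> sets Omega" and t: "0 \<le> t"
  shows "(\<integral>\<^sup>+\<omega>\<in>{0..t}. decr_rearr (indicator E) \<omega> \<partial>lebesgue) = ennreal (min t (measure Omega E))"
proof -
  let ?m = "measure Omega E"
  have "(\<integral>\<^sup>+\<omega>\<in>{0..t}. decr_rearr (indicator E) \<omega> \<partial>lebesgue)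
      = (\<integral>\<^sup>+\<omega>. indicator ({0..t} \<inter> {..<?m}) \<omega> \<partial>lebesgue)"
    using decr_rearr_indicator[OF assms(1)]
    by (intro nn_integral_cong) (auto split: split_indicator)
  also have "\<dots> = emeasure lebesgue ({0..t} \<inter> {..<?m})"
    by (simp add: sets.Int)
  also have "\<dots> = ennreal (min t ?m)"
  proof (cases "t < ?m")
    case True
    then have "{0..t} \<inter> {..<?m} = {0..t}"
      by auto
    then show ?thesis
      using t True by simp
  next
    case False
    then have "{0..t} \<inter> {..<?m} = {0..<?m}"
      by auto
    then show ?thesis
      using t False by simp
  qed
  finally show ?thesis .
qed

text \<open>The consequences of concavity on which the Marcinkiewicz norm and the shape argument
  rest.\<close>

locale quasiconcave =
  fixes \<phi> :: "real \<Rightarrow> real"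
  assumes zero: "\<phi> 0 = 0" and one: "\<phi> 1 = 1"
    and mono: "\<And>s t. 0 \<le> s \<Longrightarrow> s \<le> t \<Longrightarrow> t \<le> 1 \<Longrightarrow> \<phi> s \<le> \<phi> t"
    and slope: "\<And>s t. 0 < s \<Longrightarrow> s \<le> t \<Longrightarrow> t \<le> 1 \<Longrightarrow> \<phi> t / t \<le> \<phi> s / s"
begin

lemma nonneg: "0 \<le> t \<Longrightarrow> t \<le> 1 \<Longrightarrow> 0 \<le> \<phi> t"
  using mono[of 0 t] zero by simp

text \<open>Let m be the measure of E. The term at t is \<phi>(t) for t \<le> m and m \<phi>(t)/t
  for t > m, so \<open>mono\<close> and \<open>slope\<close> bound it by \<phi>(m), attained at t =
  m. If m = 0, all terms vanish.\<close>

lemma marcinkiewicz_indicator: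
  assumes E: "E \<in> sets Omega"
  shows "marcinkiewicz_norm \<phi> (indicator E) = ennreal (\<phi> (measure Omega E))"
proof -
  let ?m = "measure Omega E"
  have m: "0 \<le> ?m" "?m \<le> 1"
    by auto
  have eq: "ennreal (\<phi> t / t) * (\<integral>\<^sup>+\<omega>\<in>{0..t}. decr_rearr (indicator E) \<omega> \<partial>lebesgue)
      = ennreal (\<phi> t / t * min t ?m)" if "t \<in> {0<..1}" for t
    using that nonneg[of t] m
    by (simp add: nn_integral_decr_rearr_indicator[OF E] ennreal_mult[symmetric])
  have le: "\<phi> t / t * min t ?m \<le> \<phi> ?m" if t: "t \<in> {0<..1}" for t
  proof (cases "t \<le> ?m")
    case True
    then show ?thesis
      using t mono[of t ?m] m by simp
  next
    case False
    show ?thesis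
    proof (cases "?m = 0")
      case True
      then show ?thesis
        using zero t by simp
    next
      case m0: False
      then have "\<phi> t / t \<le> \<phi> ?m / ?m"
        using slope[of ?m t] t m False by auto
      then show ?thesis
        using m m0 False by (simp add: pos_le_divide_eq)
    qed
  qed
  show ?thesis
    unfolding marcinkiewicz_norm_def
  proof (rule antisym)
    show "(SUP t\<in>{0<..1}. ennreal (\<phi> t / t) * (\<integral>\<^sup>+\<omega>\<in>{0..t}. decr_rearr (indicator E) \<omega> \<partial>lebesgue))
        \<le> ennreal (\<phi> ?m)"
      by (intro SUP_least) (simp only: eq ennreal_leI le)
    show "ennreal (\<phi> ?m)
        \<le> (SUP t\<in>{0<..1}. ennreal (\<phi> t / t) * (\<integral>\<^sup>+\<omega>\<in>{0..t}. decr_rearr (indicator E) \<omega> \<partial>lebesgue))"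
    proof (cases "?m = 0")
      case True
      then show ?thesis
        using zero by simp
    next
      case False
      with m have "?m \<in> {0<..1}"
        by (simp add: zero_less_measure_iff)
      then show ?thesis
        by (intro SUP_upper2[of ?m]) (auto simp: eq)
    qed
  qed
qed

text \<open>This is the term t = 1 of the supremum. It yields the constant 1 in the integral axiom
  and the definiteness of the norm.\<close>

lemma nn_integral_le_marcinkiewicz:
  assumes [measurable]: "X \<in> borel_measurable Omega"
  shows "integral\<^sup>N Omega X \<le> marcinkiewicz_norm \<phi> X"
  unfolding marcinkiewicz_norm_def nn_integral_decr_rearr[of X "\<lambda>x. x", OF assms, simplified]
  by (rule SUP_upper2[of 1]) (auto simp: one)

lemma marcinkiewicz_mono:
  assumes "X \<in> borel_measurable Omega" "Y \<in> borel_measurable Omega"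
    and "AE \<omega> in Omega. X \<omega> \<le> Y \<omega>"
  shows "marcinkiewicz_norm \<phi> X \<le> marcinkiewicz_norm \<phi> Y"
  unfolding marcinkiewicz_norm_def
  by (intro SUP_mono' mult_left_mono nn_integral_mono mult_right_mono decr_rearr_mono[OF assms]) auto

text \<open>Monotone convergence handles each t, and the suprema over t and n commute.\<close>

lemma marcinkiewicz_fatou:
  assumes Xn [measurable]: "\<And>n. Xn n \<in> borel_measurable Omega"
    and X [measurable]: "X \<in> borel_measurable Omega"
    and lim: "AE \<omega> in Omega. incseq (\<lambda>n. Xn n \<omega>) \<and> (\<lambda>n. Xn n \<omega>) \<longlonglongrightarrow> X \<omega>"
  shows "(\<lambda>n. marcinkiewicz_norm \<phi> (Xn n)) \<longlonglongrightarrow> marcinkiewicz_norm \<phi> X"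
proof -
  note rearr = decr_rearr_SUP[OF Xn X lim]
  have int: "(SUP n. \<integral>\<^sup>+\<omega>\<in>{0..t}. decr_rearr (Xn n) \<omega> \<partial>lebesgue)
      = (\<integral>\<^sup>+\<omega>\<in>{0..t}. decr_rearr X \<omega> \<partial>lebesgue)" for t
  proof -
    have "(SUP n. \<integral>\<^sup>+\<omega>\<in>{0..t}. decr_rearr (Xn n) \<omega> \<partial>lebesgue)
        = (\<integral>\<^sup>+\<omega>. (SUP n. decr_rearr (Xn n) \<omega> * indicator {0..t} \<omega>) \<partial>lebesgue)"
      using rearr(1)
      by (intro nn_integral_monotone_convergence_SUP[symmetric])
        (auto simp: incseq_def le_fun_def intro!: mult_right_mono, measurable)
    also have "\<dots> = (\<integral>\<^sup>+\<omega>\<in>{0..t}. decr_rearr X \<omega> \<partial>lebesgue)"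
      by (simp add: SUP_mult_right_ennreal[symmetric] rearr(2))
    finally show ?thesis .
  qed
  have "marcinkiewicz_norm \<phi> X
      = (SUP t\<in>{0<..1}. SUP n. ennreal (\<phi> t / t) * (\<integral>\<^sup>+\<omega>\<in>{0..t}. decr_rearr (Xn n) \<omega> \<partial>lebesgue))"
    unfolding marcinkiewicz_norm_def by (simp add: SUP_mult_left_ennreal[symmetric] int)
  also have "\<dots> = (SUP n. marcinkiewicz_norm \<phi> (Xn n))"
    unfolding marcinkiewicz_norm_def by (rule SUP_commute)
  finally have "marcinkiewicz_norm \<phi> X = (SUP n. marcinkiewicz_norm \<phi> (Xn n))" .
  moreover have "incseq (\<lambda>n. marcinkiewicz_norm \<phi> (Xn n))"
    using lim by (intro incseq_SucI marcinkiewicz_mono) (auto simp: incseq_Suc_iff)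
  ultimately show ?thesis
    using LIMSEQ_SUP by metis
qed

lemma marcinkiewicz_subadditive:
  assumes [measurable]: "X \<in> borel_measurable Omega" "Y \<in> borel_measurable Omega"
  shows "marcinkiewicz_norm \<phi> (\<lambda>\<omega>. X \<omega> + Y \<omega>) \<le> marcinkiewicz_norm \<phi> X + marcinkiewicz_norm \<phi> Y"
  unfolding marcinkiewicz_norm_def
proof (rule SUP_least)
  fix t :: real
  assume t: "t \<in> {0<..1}"
  let ?I = "\<lambda>Z. \<integral>\<^sup>+\<omega>\<in>{0..t}. decr_rearr Z \<omega> \<partial>lebesgue"
  have "ennreal (\<phi> t / t) * ?I (\<lambda>\<omega>. X \<omega> + Y \<omega>) \<le> ennreal (\<phi> t / t) * (?I X + ?I Y)"
    using t by (intro mult_left_mono nn_integral_decr_rearr_subadditive) auto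
  also have "\<dots> = ennreal (\<phi> t / t) * ?I X + ennreal (\<phi> t / t) * ?I Y"
    by (simp add: distrib_left)
  also have "\<dots> \<le> (SUP t\<in>{0<..1}. ennreal (\<phi> t / t) * (\<integral>\<^sup>+\<omega>\<in>{0..t}. decr_rearr X \<omega> \<partial>lebesgue))
      + (SUP t\<in>{0<..1}. ennreal (\<phi> t / t) * (\<integral>\<^sup>+\<omega>\<in>{0..t}. decr_rearr Y \<omega> \<partial>lebesgue))"
    using t by (intro add_mono SUP_upper) auto
  finally show "ennreal (\<phi> t / t) * ?I (\<lambda>\<omega>. X \<omega> + Y \<omega>) \<le> \<dots>" .
qed

lemma marcinkiewicz_zero_iff:
  assumes [measurable]: "X \<in> borel_measurable Omega"
  shows "marcinkiewicz_norm \<phi> X = 0 \<longleftrightarrow> (AE \<omega> in Omega. X \<omega> = 0)"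
proof
  assume "marcinkiewicz_norm \<phi> X = 0"
  then have "integral\<^sup>N Omega X = 0"
    using nn_integral_le_marcinkiewicz[of X] by simp
  then show "AE \<omega> in Omega. X \<omega> = 0"
    by (simp add: nn_integral_0_iff_AE)
next
  assume "AE \<omega> in Omega. X \<omega> = 0"
  then have "marcinkiewicz_norm \<phi> X \<le> marcinkiewicz_norm \<phi> (indicator {})"
    by (intro marcinkiewicz_mono) auto
  also have "\<dots> = 0"
    by (subst marcinkiewicz_indicator) (auto simp: zero)
  finally show "marcinkiewicz_norm \<phi> X = 0"
    by simp
qed

lemma marcinkiewicz_cmult:
  assumes [measurable]: "X \<in> borel_measurable Omega" and "0 \<le> c"
  shows "marcinkiewicz_norm \<phi> (\<lambda>\<omega>. ennreal c * X \<omega>) = ennreal c * marcinkiewicz_norm \<phi> X"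
proof (cases "c = 0")
  case True
  then show ?thesis
    by (simp add: marcinkiewicz_zero_iff)
next
  case False
  then have "0 < c"
    using assms by simp
  then show ?thesis
    unfolding marcinkiewicz_norm_def SUP_mult_left_ennreal
    by (intro SUP_cong) (simp_all add: decr_rearr_cmult nn_integral_cmult ac_simps)
qed

lemma marcinkiewicz_banach: "banach_function_norm (marcinkiewicz_norm \<phi>)"
  unfolding banach_function_norm_def
proof (intro conjI ballI allI impI)
  fix E assume E: "E \<in> sets Omega"
  show "marcinkiewicz_norm \<phi> (indicator E) < \<infinity>"
    by (simp add: marcinkiewicz_indicator[OF E])
  show "\<exists>c::real. \<forall>X\<in>borel_measurable Omega. (\<integral>\<^sup>+\<omega>\<in>E. X \<omega> \<partial>Omega) \<le> ennreal c * marcinkiewicz_norm \<phi> X"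
  proof (intro exI[of _ 1] ballI)
    fix X :: "real \<Rightarrow> ennreal"
    assume X: "X \<in> borel_measurable Omega"
    have "(\<integral>\<^sup>+\<omega>\<in>E. X \<omega> \<partial>Omega) \<le> integral\<^sup>N Omega X"
      by (intro nn_integral_mono) (simp split: split_indicator)
    then show "(\<integral>\<^sup>+\<omega>\<in>E. X \<omega> \<partial>Omega) \<le> ennreal 1 * marcinkiewicz_norm \<phi> X"
      using nn_integral_le_marcinkiewicz[OF X] by simp
  qed
next
  show "marcinkiewicz_norm \<phi> (indicator (space Omega)) = 1"
    by (subst marcinkiewicz_indicator) (auto simp: one Omega.prob_space)
qed (auto simp: marcinkiewicz_zero_iff marcinkiewicz_cmult
    intro: marcinkiewicz_subadditive marcinkiewicz_mono marcinkiewicz_fatou)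

lemma marcinkiewicz_ri: "ri_function_norm (marcinkiewicz_norm \<phi>)"
  unfolding ri_function_norm_def
  using marcinkiewicz_banach decr_rearr_cong by (auto simp: marcinkiewicz_norm_def)

lemma marcinkiewicz_fundamental: "has_fundamental_function (marcinkiewicz_norm \<phi>) \<phi>"
  by (simp add: has_fundamental_function_def marcinkiewicz_indicator)

end

text \<open>The chord from (s, \<phi>(s)) to (1, 1) lies below \<phi> and does not decrease, because
  \<phi> \<le> 1; this gives monotonicity. The chord from the origin to (t, \<phi>(t)) lies below
  \<phi> too; this gives the decrease of \<phi>(t)/t.\<close>

lemma concave_quasiconcave:
  assumes conc: "concave_on {0..1} \<phi>" and range: "\<phi> ` {0..1} \<subseteq> {0..1}"
    and zero: "\<phi> 0 = 0" and one: "\<phi> 1 = 1"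
  shows "quasiconcave \<phi>"
proof
  have conc': "concave_on {a..b} \<phi>" if "0 \<le> a" "b \<le> 1" for a b
    using conc that unfolding concave_on_def by (auto intro: convex_on_subset)
  fix s t :: real
  show "\<phi> s \<le> \<phi> t" if st: "0 \<le> s" "s \<le> t" "t \<le> 1"
  proof (cases "s = t")
    case False
    have "\<phi> s \<le> 1"
      using range st by (auto simp: image_subset_iff)
    have "(\<phi> s - \<phi> 1) / (1 - s) * (1 - t) + \<phi> 1 \<le> \<phi> t"
      using st by (intro concave_onD_Icc'' conc') auto
    moreover have "(\<phi> s - 1) * ((1 - t) / (1 - s)) \<ge> (\<phi> s - 1) * 1"
      using st False \<open>\<phi> s \<le> 1\<close> by (intro mult_left_mono_neg) auto
    ultimately show ?thesis
      using one by simp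
  qed simp
  show "\<phi> t / t \<le> \<phi> s / s" if st: "0 < s" "s \<le> t" "t \<le> 1"
  proof -
    have "(\<phi> t - \<phi> 0) / (t - 0) * (s - 0) + \<phi> 0 \<le> \<phi> s"
      using st by (intro concave_onD_Icc' conc') auto
    then show ?thesis
      using st zero by (simp add: pos_le_divide_eq)
  qed
qed (fact zero one)+

subsection \<open>Coincidence of the Marcinkiewicz and Lorentz norms\<close>

text \<open>Needed because \<^term>\<open>deriv \<phi>\<close> is not known to be measurable; the integral of
  an arbitrary function is a lower integral.\<close>

lemma nn_integral_superadditive:
  "integral\<^sup>N M f + integral\<^sup>N M g \<le> (\<integral>\<^sup>+x. f x + g x \<partial>M)"
proof -
  let ?S = "\<lambda>f. {u. simple_function M u \<and> u \<le> f}"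
  have ne: "?S f \<noteq> {}" for f :: "'a \<Rightarrow> ennreal"
    by (auto intro!: exI[of _ "\<lambda>_. 0"] simp: le_fun_def)
  have "integral\<^sup>S M u + integral\<^sup>S M v \<le> (\<integral>\<^sup>+x. f x + g x \<partial>M)"
    if u: "u \<in> ?S f" and v: "v \<in> ?S g" for u v
  proof -
    have "integral\<^sup>S M u + integral\<^sup>S M v = integral\<^sup>N M u + integral\<^sup>N M v"
      using u v by (simp add: nn_integral_eq_simple_integral)
    also have "\<dots> = (\<integral>\<^sup>+x. u x + v x \<partial>M)"
      using u v by (intro nn_integral_add[symmetric]) (auto intro: borel_measurable_simple_function)
    also have "\<dots> \<le> (\<integral>\<^sup>+x. f x + g x \<partial>M)"
      using u v by (intro nn_integral_mono add_mono) (auto simp: le_fun_def)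
    finally show ?thesis .
  qed
  then have "integral\<^sup>N M f + integral\<^sup>S M v \<le> (\<integral>\<^sup>+x. f x + g x \<partial>M)" if "v \<in> ?S g" for v
    using that ne[of f] unfolding nn_integral_def[of M f]
    by (subst ennreal_SUP_add_left[symmetric]) (auto intro!: SUP_least)
  then show ?thesis
    using ne[of g] unfolding nn_integral_def[of M g]
    by (subst ennreal_SUP_add_right) (auto intro!: SUP_least)
qed

text \<open>Of the additivity on comonotone pairs this is the half that makes the Lorentz norm of a
  sum large, and it holds for lower integrals.\<close>

lemma lorentz_superadditive:
  assumes le: "\<And>\<omega>. 0 \<le> \<omega> \<Longrightarrow> \<omega> \<le> 1 \<Longrightarrow> decr_rearr X \<omega> + decr_rearr Y \<omega> \<le> decr_rearr Z \<omega>"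
  shows "lorentz_norm \<phi> X + lorentz_norm \<phi> Y \<le> lorentz_norm \<phi> Z"
proof -
  let ?d = "\<lambda>\<omega>. ennreal (deriv \<phi> \<omega>)" and ?c = "ennreal (Lim (at_right 0) \<phi>)"
  let ?I = "\<lambda>X. \<integral>\<^sup>+\<omega>\<in>{0..1}. decr_rearr X \<omega> * ?d \<omega> \<partial>lebesgue"
  have "?I X + ?I Y \<le> (\<integral>\<^sup>+\<omega>. decr_rearr X \<omega> * ?d \<omega> * indicator {0..1} \<omega>
      + decr_rearr Y \<omega> * ?d \<omega> * indicator {0..1} \<omega> \<partial>lebesgue)"
    by (rule nn_integral_superadditive)
  also have "\<dots> \<le> ?I Z"
    using le by (intro nn_integral_mono)
      (auto simp: distrib_right[symmetric] intro!: mult_right_mono split: split_indicator)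
  finally have "?I X + ?I Y \<le> ?I Z" .
  moreover have "decr_rearr X 0 * ?c + decr_rearr Y 0 * ?c \<le> decr_rearr Z 0 * ?c"
    using le[of 0] by (simp add: distrib_right[symmetric] mult_right_mono)
  ultimately have "(decr_rearr X 0 * ?c + decr_rearr Y 0 * ?c) + (?I X + ?I Y)
      \<le> decr_rearr Z 0 * ?c + ?I Z"
    by (rule add_mono[rotated])
  then show ?thesis
    unfolding lorentz_norm_def by (simp add: ac_simps)
qed

text \<open>The sum is 2 on E and 1 on the rest of Omega. Were its rearrangement at \<omega> too
  small, the superlevel set at that value would contain E, or all of Omega, and so have measure
  above \<omega>, against the inversion formula. For \<omega> \<ge> 1 the left side is 0.\<close>

lemma decr_rearr_indicator_add_one:
  assumes E [measurable]: "E \<in> sets Omega" and \<omega>: "0 \<le> \<omega>"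
  shows "decr_rearr (indicator E) \<omega> + decr_rearr (indicator (space Omega)) \<omega>
    \<le> decr_rearr (\<lambda>\<omega>. indicator E \<omega> + indicator (space Omega) \<omega>) \<omega>"
    (is "?l \<le> decr_rearr ?Z \<omega>")
proof (rule ccontr)
  assume "\<not> ?l \<le> decr_rearr ?Z \<omega>"
  let ?z = "decr_rearr ?Z \<omega>"
  have z: "?z < ?l"
    using \<open>\<not> ?l \<le> decr_rearr ?Z \<omega>\<close> by simp
  have l: "?l = indicator {..<measure Omega E} \<omega> + indicator {..<1} \<omega>"
    using decr_rearr_indicator[OF E \<omega>] decr_rearr_indicator[OF sets.top \<omega>]
    by (simp add: Omega.prob_space)
  have d: "distr_fun ?Z ?z \<le> ennreal \<omega>"
    by (subst decr_rearr_le_iff[symmetric]) auto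
  have m: "measure Omega E \<le> 1"
    by simp
  consider "\<omega> < measure Omega E" | "measure Omega E \<le> \<omega>" "\<omega> < 1" | "measure Omega E \<le> \<omega>" "1 \<le> \<omega>"
    by linarith
  then show False
  proof cases
    case 1
    then have "?z < 1 + 1"
      using z m unfolding l by simp
    then have "emeasure Omega E \<le> distr_fun ?Z ?z"
      using sets.sets_into_space[OF E] by (intro emeasure_mono) auto
    then have "ennreal (measure Omega E) \<le> ennreal \<omega>"
      unfolding Omega.emeasure_eq_measure[of E, symmetric] using d by (rule order_trans)
    then show False
      using 1 \<omega> by simp
  next
    case 2
    then have "?z < 1"
      using z unfolding l by simp
    then have "?z < ?Z x" if "x \<in> space Omega" for x
      using that by (auto simp: indicator_def intro: less_le_trans[of _ 1])
    then have "emeasure Omega (space Omega) \<le> distr_fun ?Z ?z"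
      by (intro emeasure_mono) auto
    then have "1 \<le> ennreal \<omega>"
      unfolding Omega.emeasure_space_1 using d by (rule order_trans)
    then show False
      using 2 by (simp add: ennreal_ge_1)
  next
    case 3
    then show False
      using z unfolding l by simp
  qed
qed

section \<open>Shape of the fundamental function forced by coincidence\<close>

context quasiconcave
begin

lemma ge_identity: "0 < s \<Longrightarrow> s \<le> 1 \<Longrightarrow> s \<le> \<phi> s"
  using slope[of s 1] one by (simp add: pos_le_divide_eq)

lemma le_one: "0 \<le> s \<Longrightarrow> s \<le> 1 \<Longrightarrow> \<phi> s \<le> 1"
  using mono[of s 1] one by simp

text \<open>The point u = s/\<phi>(s) is where the line through the origin and (s, \<phi>(s))
  reaches height 1. Splitting the range of t at s and u bounds the Marcinkiewicz norm of the
  indicator of [0,s] plus 1; this bound attains the required \<phi>(s) + 1 only if \<phi>(u) =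
  1.\<close>

lemma chord_reaches_one:
  assumes eq: "\<And>X. X \<in> borel_measurable Omega \<Longrightarrow> marcinkiewicz_norm \<phi> X = lorentz_norm \<phi> X"
    and s: "0 < s" "s \<le> 1" "\<phi> s < 1"
  shows "\<phi> (s / \<phi> s) = 1"
proof -
  let ?E = "{0..s}" and ?Z = "\<lambda>\<omega>. indicator {0..s} \<omega> + indicator (space Omega) \<omega> :: ennreal"
  let ?u = "s / \<phi> s"
  have E [measurable]: "?E \<in> sets Omega"
    using s by (intro sets_OmegaI) auto
  have mE: "measure Omega ?E = s"
    using s emeasure_Omega[of ?E] by (simp add: measure_def)
  have \<phi>s: "s \<le> \<phi> s"
    using ge_identity s by auto
  then have u: "0 < ?u" "?u \<le> 1"
    using s by (auto simp: divide_le_eq)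
  have \<phi>u: "\<phi> ?u \<le> 1"
    using le_one u by auto
  \<comment> \<open>One entry for each of the ranges t \<le> s, s \<le> t \<le> u and u \<le> t. In
    the last two the term is \<phi>(t) + s \<phi>(t)/t, with the first summand bounded at the right
    end and the second at the left end; note s/u = \<phi>(s).\<close>
  let ?B = "max (2 * \<phi> s) (max (\<phi> ?u + \<phi> s) (1 + \<phi> s * \<phi> ?u))"
  have bound: "\<phi> t / t * (min t s + t) \<le> ?B" if t: "0 < t" "t \<le> 1" for t
  proof -
    consider "t \<le> s" | "s \<le> t" "t \<le> ?u" | "s \<le> t" "?u \<le> t"
      by linarith
    then show ?thesis
    proof cases
      case 1
      then have "\<phi> t / t * (min t s + t) = 2 * \<phi> t"
        using t by (simp add: field_simps)
      also have "\<dots> \<le> 2 * \<phi> s"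
        using mono[of t s] 1 t s by simp
      finally show ?thesis
        by simp
    next
      case 2
      then have "\<phi> t / t * (min t s + t) = \<phi> t + s * (\<phi> t / t)"
        using t by (simp add: field_simps)
      also have "\<dots> \<le> \<phi> ?u + s * (\<phi> s / s)"
        using mono[of t ?u] slope[of s t] 2 t s u by (intro add_mono mult_left_mono) auto
      finally show ?thesis
        using s by simp
    next
      case 3
      then have "\<phi> t / t * (min t s + t) = \<phi> t + s * (\<phi> t / t)"
        using t by (simp add: field_simps)
      also have "\<dots> \<le> 1 + s * (\<phi> ?u / ?u)"
        using le_one[of t] slope[of ?u t] 3 t s u by (intro add_mono mult_left_mono) auto
      also have "\<dots> = 1 + \<phi> s * \<phi> ?u"
        using s \<phi>s by (simp add: field_simps)
      finally show ?thesis
        by simp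
    qed
  qed
  have "ennreal (\<phi> s + 1) = marcinkiewicz_norm \<phi> (indicator ?E) + marcinkiewicz_norm \<phi> (indicator (space Omega))"
    using s \<phi>s by (simp add: marcinkiewicz_indicator E mE one Omega.prob_space ennreal_plus)
  also have "\<dots> = lorentz_norm \<phi> (indicator ?E) + lorentz_norm \<phi> (indicator (space Omega))"
    by (simp add: eq)
  also have "\<dots> \<le> lorentz_norm \<phi> ?Z"
    by (intro lorentz_superadditive decr_rearr_indicator_add_one E)
  also have "\<dots> = marcinkiewicz_norm \<phi> ?Z"
    by (simp add: eq)
  also have "\<dots> \<le> ennreal ?B"
    unfolding marcinkiewicz_norm_def
  proof (rule SUP_least)
    fix t :: real
    assume "t \<in> {0<..1}"
    then have t: "0 < t" "t \<le> 1"
      by auto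
    have "(\<integral>\<^sup>+\<omega>\<in>{0..t}. decr_rearr ?Z \<omega> \<partial>lebesgue) \<le> ennreal (min t s) + ennreal (min t 1)"
      using nn_integral_decr_rearr_subadditive[of "indicator ?E" "indicator (space Omega)" t] t
      by (simp add: nn_integral_decr_rearr_indicator[OF E] mE
          nn_integral_decr_rearr_indicator[OF sets.top] Omega.prob_space)
    also have "\<dots> = ennreal (min t s + t)"
      using t s by (simp add: ennreal_plus min_def)
    finally have "ennreal (\<phi> t / t) * (\<integral>\<^sup>+\<omega>\<in>{0..t}. decr_rearr ?Z \<omega> \<partial>lebesgue)
        \<le> ennreal (\<phi> t / t) * ennreal (min t s + t)"
      by (rule mult_left_mono) simp
    also have "\<dots> = ennreal (\<phi> t / t * (min t s + t))"
      using t s nonneg[of t] by (intro ennreal_mult[symmetric]) auto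
    also have "\<dots> \<le> ennreal ?B"
      by (rule ennreal_leI[OF bound[OF t]])
    finally show "ennreal (\<phi> t / t) * (\<integral>\<^sup>+\<omega>\<in>{0..t}. decr_rearr ?Z \<omega> \<partial>lebesgue) \<le> ennreal ?B" .
  qed
  finally have "ennreal (\<phi> s + 1) \<le> ennreal ?B" .
  then have "\<phi> s + 1 \<le> ?B"
    using s \<phi>s by (subst (asm) ennreal_le_iff) (auto simp: le_max_iff_disj)
  \<comment> \<open>The entry 2 \<phi>(s) drops out because \<phi>(s) < 1; either of the others
    forces \<phi>(u) \<ge> 1.\<close>
  then have "1 \<le> \<phi> ?u \<or> \<phi> s * 1 \<le> \<phi> s * \<phi> ?u"
    using s(3) by (auto simp: max_def split: if_splits)
  then have "1 \<le> \<phi> ?u"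
    using s \<phi>s by auto
  then show ?thesis
    using \<phi>u by simp
qed

text \<open>Where \<phi> stays below 1, the decreasing slope \<phi>(t)/t takes the same value at s
  and at u = s/\<phi>(s), hence is constant in between; so \<phi> is linear until it reaches 1. If
  it is never below 1 on (0,1], only the jump at 0 remains.\<close>

lemma shape_if_chord_reaches_one:
  assumes chord: "\<And>s. 0 < s \<Longrightarrow> s \<le> 1 \<Longrightarrow> \<phi> s < 1 \<Longrightarrow> \<phi> (s / \<phi> s) = 1"
  shows "(\<exists>\<alpha>\<in>{0..<1}. \<forall>t\<in>{0..1}. \<phi> t = min (t / (1 - \<alpha>)) 1)
    \<or> (\<forall>t\<in>{0..1}. \<phi> t = (if t > 0 then 1 else 0))"
proof (cases "\<exists>s. 0 < s \<and> s \<le> 1 \<and> \<phi> s < 1")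
  case False
  have "\<phi> t = 1" if "0 < t" "t \<le> 1" for t
  proof -
    have "\<not> \<phi> t < 1"
      using False that by blast
    then show ?thesis
      using le_one[of t] that by simp
  qed
  then show ?thesis
    using zero by auto
next
  case True
  then obtain s0 where s0: "0 < s0" "s0 \<le> 1" "\<phi> s0 < 1"
    by blast
  define c where "c = \<phi> s0 / s0"
  have pos: "0 < \<phi> s" if "0 < s" "s \<le> 1" for s
    using ge_identity[of s] that by linarith
  have same_slope: "\<phi> s / s = \<phi> t / t" if s: "0 < s" "\<phi> s < 1" and t: "t \<le> 1" "\<phi> t < 1" and "s \<le> t" for s t
  proof (rule antisym)
    have s1: "s \<le> 1"
      using that by auto
    let ?u = "s / \<phi> s"
    have u: "0 < ?u" "?u \<le> 1" "\<phi> ?u = 1"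
      using s s1 pos[of s] ge_identity[of s] chord[of s] by (auto simp: divide_le_eq)
    \<comment> \<open>Monotonicity with \<phi>(t) < 1 = \<phi>(u) places t to the left of u, and
      \<phi>(u)/u is again \<phi>(s)/s.\<close>
    have "t \<le> ?u"
      using mono[of ?u t] u t by force
    then have "\<phi> ?u / ?u \<le> \<phi> t / t"
      using slope[of t ?u] u s that by auto
    then show "\<phi> s / s \<le> \<phi> t / t"
      using u by simp
    show "\<phi> t / t \<le> \<phi> s / s"
      using slope that by auto
  qed
  have below: "\<phi> t = c * t" if "0 < t" "t \<le> 1" "\<phi> t < 1" for t
    using same_slope[of t s0] same_slope[of s0 t] s0 that
    unfolding c_def by (cases "t \<le> s0") (auto simp: field_simps)
  have c: "1 \<le> c"
    using ge_identity[of s0] s0 unfolding c_def by (simp add: le_divide_eq)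
  \<comment> \<open>Together with \<open>below\<close> this decides which argument of the minimum is
    taken.\<close>
  have above: "1 \<le> c * t" if t: "0 < t" "t \<le> 1" "\<phi> t = 1" for t
  proof -
    have "s0 \<le> t"
      using mono[of t s0] s0 t by force
    then have "1 / t \<le> c"
      using slope[of s0 t] s0 t unfolding c_def by auto
    then show ?thesis
      using t by (simp add: divide_le_eq)
  qed
  have "\<phi> t = min (t / (1 - (1 - 1 / c))) 1" if t: "0 \<le> t" "t \<le> 1" for t
  proof -
    have "t / (1 - (1 - 1 / c)) = c * t"
      by (simp add: mult.commute)
    moreover have "\<phi> t = min (c * t) 1"
    proof (cases "t = 0")
      case False
      then show ?thesis
        using below[of t] above[of t] le_one[of t] t by (cases "\<phi> t < 1") (auto simp: min_def)
    qed (simp add: zero)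
    ultimately show ?thesis
      by (simp only:)
  qed
  moreover have "1 - 1 / c \<in> {0..<1}"
    using c by simp
  ultimately show ?thesis
    by (intro disjI1 bexI[of _ "1 - 1 / c"]) auto
qed

end

subsection \<open>Norms with an extremal fundamental function\<close>

locale ri_norm =
  fixes R :: "(real \<Rightarrow> ennreal) \<Rightarrow> ennreal" and \<phi> :: "real \<Rightarrow> real"
  assumes ri: "ri_function_norm R" and fundamental: "has_fundamental_function R \<phi>"
begin

lemma cmult:
  "X \<in> borel_measurable Omega \<Longrightarrow> 0 \<le> c \<Longrightarrow> R (\<lambda>\<omega>. ennreal c * X \<omega>) = ennreal c * R X"
  using ri by (auto simp: ri_function_norm_def banach_function_norm_def)

lemma subadditive:
  "X \<in> borel_measurable Omega \<Longrightarrow> Y \<in> borel_measurable Omega \<Longrightarrow> R (\<lambda>\<omega>. X \<omega> + Y \<omega>) \<le> R X + R Y"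
  using ri by (auto simp: ri_function_norm_def banach_function_norm_def)

lemma mono_AE:
  "X \<in> borel_measurable Omega \<Longrightarrow> Y \<in> borel_measurable Omega \<Longrightarrow> AE \<omega> in Omega. X \<omega> \<le> Y \<omega> \<Longrightarrow> R X \<le> R Y"
  using ri by (auto simp: ri_function_norm_def banach_function_norm_def)

lemma fatou:
  "(\<And>n. Xn n \<in> borel_measurable Omega) \<Longrightarrow> X \<in> borel_measurable Omega \<Longrightarrow>
    AE \<omega> in Omega. incseq (\<lambda>n. Xn n \<omega>) \<and> (\<lambda>n. Xn n \<omega>) \<longlonglongrightarrow> X \<omega> \<Longrightarrow> (\<lambda>n. R (Xn n)) \<longlonglongrightarrow> R X"
  using ri by (auto simp: ri_function_norm_def banach_function_norm_def)

lemma equimeasurable_eq: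
  "X \<in> borel_measurable Omega \<Longrightarrow> Y \<in> borel_measurable Omega \<Longrightarrow> equimeasurable X Y \<Longrightarrow> R X = R Y"
  using ri by (auto simp: ri_function_norm_def)

lemma indicator_eq: "E \<in> sets Omega \<Longrightarrow> R (indicator E) = ennreal (\<phi> (measure Omega E))"
  using fundamental by (auto simp: has_fundamental_function_def)

lemma space_eq_1: "R (indicator (space Omega)) = 1"
  using ri by (auto simp: ri_function_norm_def banach_function_norm_def)

text \<open>Norms act on functions on the whole real line, and monotonicity almost everywhere in
  Omega makes the values outside [0,1] irrelevant.\<close>

lemma eq_on_space: "X \<in> borel_measurable Omega \<Longrightarrow> (\<And>\<omega>. \<omega> \<in> space Omega \<Longrightarrow> X \<omega> = Y \<omega>) \<Longrightarrow> R X = R Y"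
  by (intro antisym mono_AE) (auto simp: measurable_cong[of Omega X Y])

lemma rearr: "X \<in> borel_measurable Omega \<Longrightarrow> R (decr_rearr X) = R X"
  by (intro equimeasurable_eq[symmetric]) (auto intro: equimeasurable_decr_rearr)

lemma sum_le:
  fixes n :: nat
  assumes "\<And>k. X k \<in> borel_measurable Omega"
  shows "R (\<lambda>\<omega>. \<Sum>k<n. X k \<omega>) \<le> (\<Sum>k<n. R (X k))"
proof (induction n)
  case 0
  show ?case
    using cmult[of "\<lambda>_. 0" 0] by simp
next
  case (Suc n)
  have "R (\<lambda>\<omega>. (\<Sum>k<n. X k \<omega>) + X n \<omega>) \<le> R (\<lambda>\<omega>. \<Sum>k<n. X k \<omega>) + R (X n)"
    using assms by (intro subadditive) auto
  also have "\<dots> \<le> (\<Sum>k<n. R (X k)) + R (X n)"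
    using Suc by (rule add_right_mono)
  finally show ?case
    by simp
qed

text \<open>The indicator of E has norm 1, and its multiple by a lies below X. Passing to y < a
  keeps the factor finite, as homogeneity concerns real factors.\<close>

lemma cmult_indicator_le:
  assumes X [measurable]: "X \<in> borel_measurable Omega" and E [measurable]: "E \<in> sets Omega"
    and full: "\<phi> (measure Omega E) = 1" and le: "\<And>\<omega>. \<omega> \<in> E \<Longrightarrow> a \<le> X \<omega>"
  shows "a \<le> R X"
proof (rule dense_le)
  fix y assume y: "y < a"
  then obtain c where c: "0 \<le> c" "y = ennreal c"
    by (cases y) auto
  have "y = R (\<lambda>\<omega>. y * indicator E \<omega>)"
    using c by (simp add: cmult indicator_eq full)
  also have "\<dots> \<le> R X"
    using y by (intro mono_AE) (auto intro!: AE_I2 order_trans[OF _ le] split: split_indicator)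
  finally show "y \<le> R X" .
qed

text \<open>The slope bound settles indicators, homogeneity and subadditivity carry it to simple
  functions, and the Fatou property to increasing limits.\<close>

lemma le_nn_integral:
  assumes X: "X \<in> borel_measurable Omega" and b: "0 < b"
    and slope: "\<And>t. 0 \<le> t \<Longrightarrow> t \<le> 1 \<Longrightarrow> \<phi> t \<le> t / b"
  shows "R X \<le> ennreal (1 / b) * integral\<^sup>N Omega X"
  using X
proof (induction rule: borel_measurable_induct)
  case (cong f g)
  have "R f = R g"
    using cong by (intro eq_on_space) auto
  moreover have "integral\<^sup>N Omega f = integral\<^sup>N Omega g"
    using cong by (intro nn_integral_cong) auto
  ultimately show ?case
    using cong by simp
next
  case (set A)
  have "ennreal (\<phi> (measure Omega A)) \<le> ennreal (1 / b * measure Omega A)"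
    using slope[of "measure Omega A"] by (intro ennreal_leI) auto
  also have "\<dots> = ennreal (1 / b) * emeasure Omega A"
    using b by (simp add: Omega.emeasure_eq_measure ennreal_mult[symmetric])
  finally show ?case
    using set by (simp add: indicator_eq)
next
  case (mult u c)
  then obtain r where "0 \<le> r" "c = ennreal r"
    by (cases c) auto
  then show ?case
    using mult mult_left_mono[OF mult.IH, of c] by (simp add: cmult nn_integral_cmult ac_simps)
next
  case (add u v)
  have "R (\<lambda>x. v x + u x) \<le> R v + R u"
    using add by (intro subadditive)
  also have "\<dots> \<le> ennreal (1 / b) * integral\<^sup>N Omega v + ennreal (1 / b) * integral\<^sup>N Omega u"
    using add by (intro add_mono)
  also have "\<dots> = ennreal (1 / b) * (\<integral>\<^sup>+x. v x + u x \<partial>Omega)"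
    using add by (simp add: nn_integral_add distrib_left)
  finally show ?case .
next
  case (seq U)
  have lim: "(\<lambda>n. R (U n)) \<longlonglongrightarrow> R (SUP i. U i)"
  proof (rule fatou)
    show "AE \<omega> in Omega. incseq (\<lambda>n. U n \<omega>) \<and> (\<lambda>n. U n \<omega>) \<longlonglongrightarrow> (SUP i. U i) \<omega>"
    proof (intro AE_I2 conjI)
      fix \<omega>
      show inc: "incseq (\<lambda>n. U n \<omega>)"
        using seq by (auto simp: incseq_def le_fun_def)
      show "(\<lambda>n. U n \<omega>) \<longlonglongrightarrow> (SUP i. U i) \<omega>"
        using LIMSEQ_SUP[OF inc] by (simp add: image_comp)
    qed
    have "(\<lambda>x. SUP i. U i x) \<in> borel_measurable Omega"
      using seq by (intro borel_measurable_SUP) auto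
    then show "(SUP i. U i) \<in> borel_measurable Omega"
      by (simp add: Sup_fun_def image_comp)
  qed (use seq in auto)
  have le: "R (U n) \<le> ennreal (1 / b) * integral\<^sup>N Omega (SUP i. U i)" for n
  proof -
    have "integral\<^sup>N Omega (U n) \<le> integral\<^sup>N Omega (SUP i. U i)"
      by (intro nn_integral_mono) (auto simp: image_comp intro: SUP_upper)
    then show ?thesis
      using seq.IH[of n] by (meson mult_left_mono order_trans zero_le)
  qed
  show ?case
    by (rule LIMSEQ_le_const2[OF lim]) (use le in blast)
qed

text \<open>At the level l = X*(1 - \<alpha>) the integral formula is exact, so CVar is l plus 1/(1
  - \<alpha>) times the integral of the positive part of X - l. The norm of that part is controlled
  by its integral, and the constant 1 has norm 1. An infinite l makes CVar infinite.\<close>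

lemma le_CVar:
  assumes X [measurable]: "X \<in> borel_measurable Omega" and \<alpha>: "0 \<le> \<alpha>" "\<alpha> < 1"
    and slope: "\<And>t. 0 \<le> t \<Longrightarrow> t \<le> 1 \<Longrightarrow> \<phi> t \<le> t / (1 - \<alpha>)"
  shows "R X \<le> CVar \<alpha> X"
proof -
  let ?b = "1 - \<alpha>" and ?l = "decr_rearr X (1 - \<alpha>)"
  let ?I = "\<integral>\<^sup>+\<omega>. X \<omega> - ?l \<partial>Omega"
  have "CVar \<alpha> X = ennreal (1 / ?b) * (?l * ennreal ?b + ?I)"
    using \<alpha> nn_integral_decr_rearr_eq[OF X, of ?b] by (simp add: CVar_def)
  also have "\<dots> = ?l * (ennreal (1 / ?b) * ennreal ?b) + ennreal (1 / ?b) * ?I"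
    by (simp add: distrib_left ac_simps)
  also have "ennreal (1 / ?b) * ennreal ?b = 1"
    using \<alpha> by (simp add: ennreal_mult[symmetric])
  finally have CVar: "CVar \<alpha> X = ?l + ennreal (1 / ?b) * ?I"
    by simp
  show ?thesis
  proof (cases "?l")
    case top
    then show ?thesis
      using CVar by simp
  next
    case (real r)
    have "R X \<le> R (\<lambda>\<omega>. ?l * indicator (space Omega) \<omega> + (X \<omega> - ?l))"
      by (intro mono_AE) (auto simp: ennreal_le_add_diff)
    also have "\<dots> \<le> R (\<lambda>\<omega>. ?l * indicator (space Omega) \<omega>) + R (\<lambda>\<omega>. X \<omega> - ?l)"
      by (intro subadditive) auto
    also have "\<dots> \<le> ?l + ennreal (1 / ?b) * ?I"
      using \<alpha> slope real by (intro add_mono le_nn_integral) (auto simp: cmult space_eq_1)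
    finally show ?thesis
      using CVar by simp
  qed
qed

end

section \<open>Lower bound by averaging cyclic shifts of a step function\<close>

lemma bij_betw_shift_mod:
  assumes "0 < n"
  shows "bij_betw (\<lambda>j. (j + k) mod n) {..<n} {..<n::nat}"
proof -
  have inj: "inj_on (\<lambda>j. (j + k) mod n) {..<n}"
  proof (rule linorder_inj_onI)
    fix i j assume "i < j" "i \<in> {..<n}" "j \<in> {..<n}"
    then show "(i + k) mod n \<noteq> (j + k) mod n"
      using mod_eq_dvd_iff_nat[of "i + k" "j + k" n] nat_dvd_not_less[of "j - i" n] by auto
  qed auto
  moreover have "(\<lambda>j. (j + k) mod n) ` {..<n} = {..<n}"
    using assms by (intro endo_inj_surj inj) auto
  ultimately show ?thesis
    by (simp add: bij_betw_def)
qed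

text \<open>A step function on \<open>n\<close> cells of equal length, cyclically shifted by \<open>k\<close> cells: the shifts are
  equimeasurable and average to a constant.\<close>

definition cyc_step :: "(nat \<Rightarrow> ennreal) \<Rightarrow> real \<Rightarrow> nat \<Rightarrow> nat \<Rightarrow> real \<Rightarrow> ennreal" where
  "cyc_step a b n k \<omega> = (if \<omega> \<in> {0..<b} then a ((nat \<lfloor>\<omega> * real n / b\<rfloor> + k) mod n) else 0)"

text \<open>The conjunct \<open>0 \<le> \<omega>\<close> is there because \<open>nat\<close> sends
  every negative index to cell 0.\<close>

lemma cell_iff:
  assumes "0 < b" "0 < n"
  shows "0 \<le> \<omega> \<and> nat \<lfloor>\<omega> * real n / b\<rfloor> = j \<longleftrightarrow> \<omega> \<in> {real j * (b / n)..<real (Suc j) * (b / n)}"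
proof -
  have *: "\<omega> \<in> {real j * (b / n)..<real (Suc j) * (b / n)} \<longleftrightarrow> real j \<le> \<omega> * real n / b \<and> \<omega> * real n / b < real j + 1"
    using assms by (auto simp: field_simps)
  show ?thesis
  proof
    assume l: "0 \<le> \<omega> \<and> nat \<lfloor>\<omega> * real n / b\<rfloor> = j"
    then have "0 \<le> \<omega> * real n / b"
      using assms by auto
    then have "real j = of_int \<lfloor>\<omega> * real n / b\<rfloor>"
      using l by force
    then show "\<omega> \<in> {real j * (b / n)..<real (Suc j) * (b / n)}"
      unfolding * by linarith
  next
    assume r: "\<omega> \<in> {real j * (b / n)..<real (Suc j) * (b / n)}"
    then have "\<lfloor>\<omega> * real n / b\<rfloor> = int j"
      unfolding * by (intro floor_unique) auto
    moreover have "0 \<le> real j * (b / n)"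
      using assms by auto
    then have "0 \<le> \<omega>"
      using r by auto
    ultimately show "0 \<le> \<omega> \<and> nat \<lfloor>\<omega> * real n / b\<rfloor> = j"
      by simp
  qed
qed

lemma cell_less:
  assumes "0 < b" "0 < n" "0 \<le> \<omega>" "\<omega> < b"
  shows "nat \<lfloor>\<omega> * real n / b\<rfloor> < n"
proof -
  have "\<omega> * real n / b < real n"
    using assms by (simp add: divide_less_eq)
  then show ?thesis
    using assms by (simp add: nat_less_iff floor_less_iff)
qed

lemma cyc_step_measurable: "cyc_step a b n k \<in> borel_measurable Omega"
proof (rule measurable_Omega)
  have "(\<lambda>\<omega>. nat \<lfloor>\<omega> * real n / b\<rfloor>) \<in> lborel \<rightarrow>\<^sub>M count_space UNIV"
    by measurable
  then have "(\<lambda>\<omega>. a ((nat \<lfloor>\<omega> * real n / b\<rfloor> + k) mod n)) \<in> borel_measurable lborel"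
    by (rule measurable_compose) auto
  then have "cyc_step a b n k \<in> borel_measurable lborel"
    unfolding cyc_step_def[abs_def] by (intro measurable_If) auto
  then show "cyc_step a b n k \<in> borel_measurable lebesgue"
    by (rule measurable_completion)
qed

text \<open>At a fixed point the n shifts visit every residue exactly once.\<close>

lemma sum_cyc_step:
  assumes "0 < n" "0 < b" "\<omega> \<in> {0..<b}"
  shows "(\<Sum>k<n. cyc_step a b n k \<omega>) = (\<Sum>j<n. a j)"
  using sum.reindex_bij_betw[OF bij_betw_shift_mod[OF assms(1), of "nat \<lfloor>\<omega> * real n / b\<rfloor>"], of a] assms(3)
  by (simp add: cyc_step_def add.commute)

text \<open>The superlevel set is a disjoint union of cells of length b/n, and a shift only permutes
  cell indices. The right side is free of k, which gives the equimeasurability of the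
  shifts.\<close>

lemma distr_fun_cyc_step:
  assumes n: "0 < n" and b: "0 < b" "b \<le> 1"
  shows "distr_fun (cyc_step a b n k) l = of_nat (card {j \<in> {..<n}. l < a j}) * ennreal (b / n)"
proof -
  let ?J = "{j \<in> {..<n}. l < a ((j + k) mod n)}"
  let ?C = "\<lambda>j. {real j * (b / n)..<real (Suc j) * (b / n)}"
  have C: "?C j \<subseteq> {0..<b}" if "j < n" for j
  proof -
    have "real (Suc j) * (b / n) \<le> real n * (b / n)"
      using that b by (intro mult_right_mono) auto
    moreover have "0 \<le> real j * (b / n)"
      using b by simp
    ultimately show ?thesis
      using n by auto
  qed
  have "{x \<in> space Omega. l < cyc_step a b n k x} = (\<Union>j\<in>?J. ?C j)"
  proof (intro equalityI subsetI)
    fix x assume x: "x \<in> {x \<in> space Omega. l < cyc_step a b n k x}"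
    then have x0: "x \<in> {0..<b}" "l < a ((nat \<lfloor>x * real n / b\<rfloor> + k) mod n)"
      by (auto simp: cyc_step_def split: if_splits)
    then show "x \<in> (\<Union>j\<in>?J. ?C j)"
      using cell_iff[OF b(1) n, of x "nat \<lfloor>x * real n / b\<rfloor>"] cell_less[OF b(1) n, of x]
      by (intro UN_I[of "nat \<lfloor>x * real n / b\<rfloor>"]) auto
  next
    fix x assume "x \<in> (\<Union>j\<in>?J. ?C j)"
    then obtain j where j: "j < n" "l < a ((j + k) mod n)" "x \<in> ?C j"
      by auto
    then have "x \<in> {0..<b}" "nat \<lfloor>x * real n / b\<rfloor> = j"
      using C[of j] cell_iff[OF b(1) n, of x j] by auto
    then show "x \<in> {x \<in> space Omega. l < cyc_step a b n k x}"
      using j b by (auto simp: cyc_step_def space_Omega)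
  qed
  moreover have "(\<Union>j\<in>?J. ?C j) \<subseteq> {0..<b}"
    using C by (intro UN_least) simp
  then have "(\<Union>j\<in>?J. ?C j) \<subseteq> {0..1}"
    by (rule order_trans) (use b in auto)
  ultimately have "distr_fun (cyc_step a b n k) l = emeasure lebesgue (\<Union>j\<in>?J. ?C j)"
    by (simp only: emeasure_Omega)
  also have "\<dots> = (\<Sum>j\<in>?J. emeasure lebesgue (?C j))"
  proof (rule sum_emeasure[symmetric])
    show "disjoint_family_on ?C ?J"
      unfolding disjoint_family_on_def
    proof (intro ballI impI equals0I)
      fix i j x
      assume "i \<noteq> j" "x \<in> ?C i \<inter> ?C j"
      then show False
        using cell_iff[OF b(1) n, of x i] cell_iff[OF b(1) n, of x j] by blast
    qed
  qed auto
  also have "\<dots> = (\<Sum>j\<in>?J. ennreal (b / n))"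
    using b by (intro sum.cong) (auto simp: field_simps)
  also have "\<dots> = of_nat (card ?J) * ennreal (b / n)"
    by simp
  also have "card ?J = card {j \<in> {..<n}. l < a j}"
  proof (rule bij_betw_same_card)
    have bij: "bij_betw (\<lambda>j. (j + k) mod n) {..<n} {..<n}"
      using n by (rule bij_betw_shift_mod)
    show "bij_betw (\<lambda>j. (j + k) mod n) ?J {j \<in> {..<n}. l < a j}"
    proof (rule bij_betw_subset[OF bij])
      show "(\<lambda>j. (j + k) mod n) ` ?J = {j \<in> {..<n}. l < a j}"
      proof (intro equalityI subsetI)
        fix i assume i: "i \<in> {j \<in> {..<n}. l < a j}"
        then obtain j where "j < n" "i = (j + k) mod n"
          using bij_betw_imp_surj_on[OF bij] by auto
        then show "i \<in> (\<lambda>j. (j + k) mod n) ` ?J"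
          using i by auto
      qed (use n in auto)
    qed auto
  qed
  finally show ?thesis .
qed

context ri_norm
begin

text \<open>The n shifts add up to a constant on [0,b), whose indicator has norm 1. They share one
  norm, at most R(X), so the sum of the \<open>a j\<close> is at most n R(X). Comparing this sum
  with the integral loses only the first cell, where X* may be unbounded.\<close>

lemma lower_step:
  assumes X [measurable]: "X \<in> borel_measurable Omega" and b: "0 < b" "b \<le> 1" "\<phi> b = 1"
    and n: "0 < n"
  shows "(\<integral>\<^sup>+\<omega>\<in>{b / real n..<b}. decr_rearr X \<omega> \<partial>lebesgue) \<le> ennreal b * R X"
proof -
  let ?f = "decr_rearr X"
  \<comment> \<open>Values at the right ends of the cells, so that the unshifted step function lies
    below X*.\<close>
  define a where "a j = ?f (real (Suc j) * (b / n))" for j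
  let ?A = "\<Sum>j<n. a j"
  let ?g = "cyc_step a b n"
  let ?C = "\<lambda>j. {real j * (b / n)..<real (Suc j) * (b / n)}"
  note [measurable] = cyc_step_measurable
  have cell: "\<omega> \<in> ?C (nat \<lfloor>\<omega> * real n / b\<rfloor>)" if "0 \<le> \<omega>" for \<omega>
    using cell_iff[OF b(1) n, of \<omega>] that by blast
  have E: "{0..<b} \<in> sets Omega"
    using b by (intro sets_OmegaI) auto
  have mE: "measure Omega {0..<b} = b"
    using b sets_OmegaD[OF E] by (simp add: measure_def emeasure_Omega)
  have "?A \<le> R (\<lambda>\<omega>. \<Sum>k<n. ?g k \<omega>)"
    using E b n by (rule_tac cmult_indicator_le[of _ "{0..<b}"]) (auto simp: mE sum_cyc_step)
  also have "\<dots> \<le> (\<Sum>k<n. R (?g k))"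
    by (rule sum_le) measurable
  also have "\<dots> = (\<Sum>k<n. R (?g 0))"
    by (intro sum.cong equimeasurable_eq)
      (auto simp: equimeasurable_def distr_fun_cyc_step[OF n b(1,2)])
  also have "\<dots> = of_nat n * R (?g 0)"
    by simp
  also have "\<dots> \<le> of_nat n * R ?f"
  proof (intro mult_left_mono mono_AE AE_I2)
    fix \<omega>
    show "?g 0 \<omega> \<le> ?f \<omega>"
      using cell[of \<omega>] cell_less[OF b(1) n, of \<omega>]
      by (auto simp: cyc_step_def a_def intro!: decr_rearr_antimono)
  qed auto
  finally have A: "?A \<le> of_nat n * R X"
    by (simp add: rearr)
  \<comment> \<open>The number \<open>a j\<close> is also the value of X* at the left end of cell j
    + 1, hence an upper bound there. The cell with index n starts at b and only enlarges the
    sum.\<close>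
  have "(\<integral>\<^sup>+\<omega>\<in>{b / real n..<b}. ?f \<omega> \<partial>lebesgue) \<le> (\<integral>\<^sup>+\<omega>. (\<Sum>j<n. a j * indicator (?C (Suc j)) \<omega>) \<partial>lebesgue)"
  proof (rule nn_integral_mono)
    fix \<omega> :: real
    show "?f \<omega> * indicator {b / real n..<b} \<omega> \<le> (\<Sum>j<n. a j * indicator (?C (Suc j)) \<omega>)"
    proof (cases "\<omega> \<in> {b / real n..<b}")
      case True
      then have \<omega>: "0 \<le> \<omega>" "1 \<le> \<omega> * real n / b" "\<omega> < b"
        using b n by (auto simp: field_simps intro: order_trans[of 0 "b / real n"])
      then have "0 < nat \<lfloor>\<omega> * real n / b\<rfloor>"
        by (simp only: zero_less_nat_eq zero_less_floor)
      then obtain j where j: "nat \<lfloor>\<omega> * real n / b\<rfloor> = Suc j"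
        using gr0_implies_Suc by blast
      then have jn: "j < n" and C: "\<omega> \<in> ?C (Suc j)"
        using cell[of \<omega>] cell_less[OF b(1) n, of \<omega>] \<omega> by auto
      have "?f \<omega> \<le> a j"
        using C unfolding a_def by (intro decr_rearr_antimono) auto
      also have "\<dots> = a j * indicator (?C (Suc j)) \<omega>"
        using C by simp
      also have "\<dots> \<le> (\<Sum>j<n. a j * indicator (?C (Suc j)) \<omega>)"
        using jn by (intro member_le_sum) auto
      finally show ?thesis
        using True by simp
    qed simp
  qed
  also have "\<dots> = (\<Sum>j<n. a j * emeasure lebesgue (?C (Suc j)))"
    by (subst nn_integral_sum) (auto simp: nn_integral_cmult_indicator)
  also have "\<dots> = (\<Sum>j<n. a j * ennreal (b / n))"
    using b by (intro sum.cong) (auto simp: field_simps)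
  also have "\<dots> = ennreal (b / n) * ?A"
    by (simp add: sum_distrib_right mult.commute)
  also have "\<dots> \<le> ennreal (b / n) * (of_nat n * R X)"
    using A by (rule mult_left_mono) simp
  also have "\<dots> = ennreal b * R X"
    using b n by (simp add: mult.assoc[symmetric] ennreal_of_nat_eq_real_of_nat ennreal_mult[symmetric])
  finally show ?thesis .
qed

text \<open>With b = 1 - \<alpha>, the intervals [b/(n+1), b) increase to (0,b), so monotone
  convergence recovers the integral up to two null endpoints.\<close>

lemma CVar_le:
  assumes X [measurable]: "X \<in> borel_measurable Omega" and \<alpha>: "0 \<le> \<alpha>" "\<alpha> < 1"
    and one: "\<phi> (1 - \<alpha>) = 1"
  shows "CVar \<alpha> X \<le> R X"
proof -
  let ?b = "1 - \<alpha>"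
  have b: "0 < ?b" "?b \<le> 1"
    using \<alpha> by auto
  let ?F = "\<lambda>n \<omega>. decr_rearr X \<omega> * indicator {?b / real (Suc n)..<?b} \<omega>"
  have F: "(SUP n. ?F n \<omega>) = decr_rearr X \<omega> * indicator {0<..<?b} \<omega>" for \<omega>
  proof (rule antisym)
    have "0 < ?b / real (Suc n)" for n
      using b by simp
    then show "(SUP n. ?F n \<omega>) \<le> decr_rearr X \<omega> * indicator {0<..<?b} \<omega>"
      by (intro SUP_least mult_left_mono) (auto split: split_indicator intro: less_le_trans)
    show "decr_rearr X \<omega> * indicator {0<..<?b} \<omega> \<le> (SUP n. ?F n \<omega>)"
    proof (cases "\<omega> \<in> {0<..<?b}")
      case True
      then obtain n where "1 / real (Suc n) < \<omega> / ?b"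
        using nat_approx_posE[of "\<omega> / ?b"] b by auto
      then have "\<omega> \<in> {?b / real (Suc n)..<?b}"
        using True b by (auto simp: field_simps)
      then show ?thesis
        using True by (intro SUP_upper2[of n]) auto
    qed simp
  qed
  have "(\<integral>\<^sup>+\<omega>\<in>{0..?b}. decr_rearr X \<omega> \<partial>lebesgue) = (\<integral>\<^sup>+\<omega>\<in>{0<..<?b}. decr_rearr X \<omega> \<partial>lebesgue)"
  proof (rule nn_integral_cong_AE)
    have "AE \<omega> in lebesgue. \<omega> \<notin> {0, ?b}"
      by (intro AE_not_in) (simp add: negligible_iff_null_sets[symmetric])
    then show "AE \<omega> in lebesgue. decr_rearr X \<omega> * indicator {0..?b} \<omega> = decr_rearr X \<omega> * indicator {0<..<?b} \<omega>"
      by eventually_elim (auto split: split_indicator)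
  qed
  also have "\<dots> = (SUP n. integral\<^sup>N lebesgue (?F n))"
  proof -
    have "incseq ?F"
    proof (rule incseq_SucI, rule le_funI)
      fix n \<omega>
      have "?b / real (Suc (Suc n)) \<le> ?b / real (Suc n)"
        using b by (intro divide_left_mono) auto
      then show "?F n \<omega> \<le> ?F (Suc n) \<omega>"
        by (intro mult_left_mono) (auto split: split_indicator)
    qed
    then show ?thesis
      unfolding F[symmetric] by (intro nn_integral_monotone_convergence_SUP) auto
  qed
  also have "\<dots> \<le> ennreal ?b * R X"
    by (intro SUP_least lower_step X b one) simp
  finally have "CVar \<alpha> X \<le> ennreal (1 / ?b) * (ennreal ?b * R X)"
    unfolding CVar_def by (rule mult_left_mono) simp
  also have "\<dots> = R X"
    using b by (simp add: mult.assoc[symmetric] ennreal_mult[symmetric])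
  finally show ?thesis .
qed

text \<open>The upper bound uses \<phi>(t) \<le> t/(1 - \<alpha>), the lower one \<phi>(1 -
  \<alpha>) = 1.\<close>

lemma eq_CVar:
  assumes "X \<in> borel_measurable Omega" and \<alpha>: "\<alpha> \<in> {0..<1}"
    and shape: "\<forall>t\<in>{0..1}. \<phi> t = min (t / (1 - \<alpha>)) 1"
  shows "R X = CVar \<alpha> X"
  using assms by (intro antisym le_CVar CVar_le) auto

text \<open>Almost everywhere X is at most X*(0), and the constant 1 has norm 1. Conversely, for y <
  X*(0) the set where X exceeds y has positive measure, so its indicator already has norm 1.\<close>

lemma eq_decr_rearr_0:
  assumes X [measurable]: "X \<in> borel_measurable Omega"
    and shape: "\<forall>t\<in>{0..1}. \<phi> t = (if t > 0 then 1 else 0)"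
  shows "R X = decr_rearr X 0"
proof (rule antisym)
  let ?l = "decr_rearr X 0"
  show "R X \<le> ?l"
  proof (cases ?l)
    case (real r)
    have "distr_fun X ?l \<le> ennreal 0"
      by (subst decr_rearr_le_iff[symmetric]) auto
    then have "AE \<omega> in Omega. X \<omega> \<le> ?l"
      by (subst AE_iff_measurable[OF _ refl]) (auto simp: not_le)
    then have "R X \<le> R (\<lambda>\<omega>. ?l * indicator (space Omega) \<omega>)"
      using AE_space by (intro mono_AE) auto
    also have "\<dots> = ?l"
      using real by (simp add: cmult space_eq_1)
    finally show ?thesis .
  qed simp
  show "?l \<le> R X"
  proof (rule dense_le)
    fix y assume "y < ?l"
    then have "0 < distr_fun X y"
      by (simp add: less_decr_rearr_iff)
    then have "0 < measure Omega {x \<in> space Omega. y < X x}"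
      by (simp add: Omega.emeasure_eq_measure)
    then show "y \<le> R X"
      using shape by (intro cmult_indicator_le[of _ "{x \<in> space Omega. y < X x}"]) auto
  qed
qed

end

section \<open>Essential supremum, and the Lorentz norm for the two extremal shapes\<close>

lemma esssup_eq_decr_rearr_0:
  assumes [measurable]: "X \<in> borel_measurable Omega"
  shows "esssup Omega X = decr_rearr X 0"
proof -
  have "(AE x in Omega. X x \<le> z) \<longleftrightarrow> distr_fun X z = 0" for z
    by (subst AE_iff_measurable[OF _ refl]) (auto simp: not_le)
  then show ?thesis
    by (simp add: esssup_eq_AE decr_rearr_def)
qed

text \<open>Here \<phi>(0+) = 0, and the derivative is 1/(1 - \<alpha>) before 1 - \<alpha> and 0
  after it. Its values at 0, 1 - \<alpha> and 1 are not controlled, but these points form a null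
  set.\<close>

lemma lorentz_eq_CVar:
  assumes X [measurable]: "X \<in> borel_measurable Omega" and \<alpha>: "\<alpha> \<in> {0..<1}"
    and shape: "\<forall>t\<in>{0..1}. \<phi> t = min (t / (1 - \<alpha>)) 1"
  shows "lorentz_norm \<phi> X = CVar \<alpha> X"
proof -
  let ?b = "1 - \<alpha>"
  have b: "0 < ?b" "?b \<le> 1"
    using \<alpha> by auto
  have lin: "\<phi> t = t / ?b" if "t \<in> {0<..<?b}" for t
    using shape that \<alpha> by (auto simp: min_def divide_le_eq)
  have const: "\<phi> t = 1" if "t \<in> {?b<..<1}" for t
    using shape that \<alpha> by (auto simp: min_def divide_le_eq)
  have "(\<phi> \<longlongrightarrow> 0) (at_right 0)"
  proof (rule Lim_transform_eventually)
    show "((\<lambda>t. t / ?b) \<longlongrightarrow> 0) (at_right 0)"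
      using b by (auto intro!: tendsto_eq_intros)
    show "\<forall>\<^sub>F t in at_right 0. t / ?b = \<phi> t"
      using eventually_at_right_real[OF b(1)] by eventually_elim (simp add: lin)
  qed
  then have "Lim (at_right 0) \<phi> = 0"
    by (intro tendsto_Lim) auto
  moreover have "(\<integral>\<^sup>+\<omega>\<in>{0..1}. decr_rearr X \<omega> * ennreal (deriv \<phi> \<omega>) \<partial>lebesgue)
      = (\<integral>\<^sup>+\<omega>. ennreal (1 / ?b) * (decr_rearr X \<omega> * indicator {0..?b} \<omega>) \<partial>lebesgue)"
  proof (rule nn_integral_cong_AE)
    have d1: "deriv \<phi> \<omega> = 1 / ?b" if "\<omega> \<in> {0<..<?b}" for \<omega>
    proof -
      have "((\<lambda>t. t / ?b) has_field_derivative 1 / ?b) (at \<omega>)"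
        using b by (auto intro!: derivative_eq_intros)
      then have "(\<phi> has_field_derivative 1 / ?b) (at \<omega>)"
        by (rule has_field_derivative_transform_within_open[of _ _ _ "{0<..<?b}"])
          (use that lin in auto)
      then show ?thesis
        by (rule DERIV_imp_deriv)
    qed
    have d0: "deriv \<phi> \<omega> = 0" if "\<omega> \<in> {?b<..<1}" for \<omega>
    proof -
      have "((\<lambda>t. 1) has_field_derivative 0) (at \<omega>)"
        by simp
      then have "(\<phi> has_field_derivative 0) (at \<omega>)"
        by (rule has_field_derivative_transform_within_open[of _ _ _ "{?b<..<1}"])
          (use that const in auto)
      then show ?thesis
        by (rule DERIV_imp_deriv)
    qed
    have "AE \<omega> in lebesgue. \<omega> \<notin> {0, ?b, 1}"
      by (intro AE_not_in) (simp add: negligible_iff_null_sets[symmetric])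
    then show "AE \<omega> in lebesgue. decr_rearr X \<omega> * ennreal (deriv \<phi> \<omega>) * indicator {0..1} \<omega>
        = ennreal (1 / ?b) * (decr_rearr X \<omega> * indicator {0..?b} \<omega>)"
    proof eventually_elim
      case (elim \<omega>)
      then consider "\<omega> \<in> {0<..<?b}" | "\<omega> \<in> {?b<..<1}" | "\<omega> < 0 \<or> 1 < \<omega>"
        using b by fastforce
      then show ?case
        using d1[of \<omega>] d0[of \<omega>] b by cases (auto simp: mult.commute split: split_indicator)
    qed
  qed
  ultimately show ?thesis
    by (simp add: lorentz_norm_def CVar_def nn_integral_cmult)
qed

text \<open>All the mass sits in the jump \<phi>(0+) = 1; the derivative vanishes on (0,1).\<close>

lemma lorentz_eq_decr_rearr_0:
  assumes shape: "\<forall>t\<in>{0..1}. \<phi> t = (if t > 0 then 1 else 0)"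
  shows "lorentz_norm \<phi> X = decr_rearr X 0"
proof -
  have const: "\<phi> t = 1" if "t \<in> {0<..<1}" for t
    using shape that by auto
  have "(\<phi> \<longlongrightarrow> 1) (at_right 0)"
  proof (rule Lim_transform_eventually)
    show "\<forall>\<^sub>F t in at_right 0. 1 = \<phi> t"
      using eventually_at_right_real[of 0 1] by (auto elim!: eventually_mono simp: const)
  qed simp
  then have "Lim (at_right 0) \<phi> = 1"
    by (intro tendsto_Lim) auto
  moreover have "(\<integral>\<^sup>+\<omega>\<in>{0..1}. decr_rearr X \<omega> * ennreal (deriv \<phi> \<omega>) \<partial>lebesgue) = (\<integral>\<^sup>+\<omega>. 0 \<partial>(lebesgue :: real measure))"
  proof (rule nn_integral_cong_AE)
    have d0: "deriv \<phi> \<omega> = 0" if "\<omega> \<in> {0<..<1}" for \<omega>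
    proof -
      have "((\<lambda>t. 1) has_field_derivative 0) (at \<omega>)"
        by simp
      then have "(\<phi> has_field_derivative 0) (at \<omega>)"
        by (rule has_field_derivative_transform_within_open[of _ _ _ "{0<..<1}"])
          (use that const in auto)
      then show ?thesis
        by (rule DERIV_imp_deriv)
    qed
    have "AE \<omega> in lebesgue. \<omega> \<notin> {0, 1::real}"
      by (intro AE_not_in) (simp add: negligible_iff_null_sets[symmetric])
    then show "AE \<omega> in lebesgue. decr_rearr X \<omega> * ennreal (deriv \<phi> \<omega>) * indicator {0..1} \<omega> = 0"
      by eventually_elim (auto simp: d0 split: split_indicator)
  qed
  ultimately show ?thesis
    by (simp add: lorentz_norm_def)
qed

section \<open>The equivalence and the explicit form of the common norm\<close>

theorem theorem20:
  fixes \<phi> :: "real \<Rightarrow> real"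
  assumes "concave_on {0..1} \<phi>"
    and "\<phi> ` {0..1} \<subseteq> {0..1}"
    and "\<phi> 0 = 0" and "\<phi> 1 = 1"
  shows "(((\<forall>R R'. ri_function_norm R \<and> has_fundamental_function R \<phi> \<and>
              ri_function_norm R' \<and> has_fundamental_function R' \<phi> \<longrightarrow>
              (\<forall>X \<in> borel_measurable Omega. R X = R' X)) \<and>
          (\<forall>R. ri_function_norm R \<and> has_fundamental_function R \<phi> \<longrightarrow>
              (\<forall>X \<in> borel_measurable Omega.
                 marcinkiewicz_norm \<phi> X = R X \<and> R X = lorentz_norm \<phi> X)))
         \<longleftrightarrow>
         ((\<exists>\<alpha>\<in>{0..<1}. \<forall>t\<in>{0..1}. \<phi> t = min (t / (1 - \<alpha>)) 1) \<or>
          (\<forall>t\<in>{0..1}. \<phi> t = (if t > 0 then 1 else 0)))) \<and>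
         (\<forall>\<alpha>\<in>{0..<1}. (\<forall>t\<in>{0..1}. \<phi> t = min (t / (1 - \<alpha>)) 1) \<longrightarrow>
           (\<forall>R. ri_function_norm R \<and> has_fundamental_function R \<phi> \<longrightarrow>
              (\<forall>X \<in> borel_measurable Omega. R X = CVar \<alpha> X))) \<and>
         ((\<forall>t\<in>{0..1}. \<phi> t = (if t > 0 then 1 else 0)) \<longrightarrow>
           (\<forall>R. ri_function_norm R \<and> has_fundamental_function R \<phi> \<longrightarrow>
              (\<forall>X \<in> borel_measurable Omega. R X = esssup Omega X)))"
proof -
  interpret quasiconcave \<phi>
    using assms by (rule concave_quasiconcave)
  let ?ri = "\<lambda>R. ri_function_norm R \<and> has_fundamental_function R \<phi>"
  let ?cvar = "\<lambda>\<alpha>. \<forall>t\<in>{0..1}. \<phi> t = min (t / (1 - \<alpha>)) 1"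
  let ?linf = "\<forall>t\<in>{0..1}. \<phi> t = (if t > 0 then 1 else 0)"
  let ?all = "\<lambda>N. \<forall>R. ?ri R \<longrightarrow> (\<forall>X\<in>borel_measurable Omega. R X = N X)"
  \<comment> \<open>A concrete norm to insert into the universally quantified conditions, which
    could otherwise hold vacuously.\<close>
  have M: "?ri (marcinkiewicz_norm \<phi>)"
    using marcinkiewicz_ri marcinkiewicz_fundamental by simp
  have cvar: "?all (CVar \<alpha>)" if "\<alpha> \<in> {0..<1}" "?cvar \<alpha>" for \<alpha>
    using ri_norm.eq_CVar[of _ \<phi> _ \<alpha>] that by (auto simp: ri_norm_def)
  have linf: "?all (\<lambda>X. decr_rearr X 0)" if "?linf"
    using ri_norm.eq_decr_rearr_0[of _ \<phi>] that by (auto simp: ri_norm_def)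
  let ?unique = "(\<forall>R R'. ri_function_norm R \<and> has_fundamental_function R \<phi> \<and> ?ri R' \<longrightarrow>
      (\<forall>X\<in>borel_measurable Omega. R X = R' X)) \<and>
    (\<forall>R. ?ri R \<longrightarrow> (\<forall>X\<in>borel_measurable Omega. marcinkiewicz_norm \<phi> X = R X \<and> R X = lorentz_norm \<phi> X))"
  \<comment> \<open>Here \<open>N\<close> is \<open>CVar \<alpha>\<close> or X*(0). The
    Marcinkiewicz norm equals \<open>N\<close> as an instance of \<open>?all N\<close>, whereas the
    Lorentz norm is compared with \<open>N\<close> by direct computation.\<close>
  have unique: "?unique"
    if N: "?all N" and L: "\<And>X. X \<in> borel_measurable Omega \<Longrightarrow> lorentz_norm \<phi> X = N X" for N
  proof (intro conjI allI impI ballI)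
    fix R R' and X :: "real \<Rightarrow> ennreal"
    assume X: "X \<in> borel_measurable Omega"
    have eq: "Q X = N X" if "?ri Q" for Q
      using N that X by blast
    show "R X = R' X" if "ri_function_norm R \<and> has_fundamental_function R \<phi> \<and> ?ri R'"
      using eq[of R] eq[of R'] that by simp
    show "marcinkiewicz_norm \<phi> X = R X" "R X = lorentz_norm \<phi> X" if "?ri R"
      using eq[OF that] eq[OF M] L[OF X] by simp_all
  qed
  have "(\<exists>\<alpha>\<in>{0..<1}. ?cvar \<alpha>) \<or> ?linf" if "?unique"
  proof (rule shape_if_chord_reaches_one, rule chord_reaches_one)
    fix X :: "real \<Rightarrow> ennreal"
    assume "X \<in> borel_measurable Omega"
    then show "marcinkiewicz_norm \<phi> X = lorentz_norm \<phi> X"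
      using that M by blast
  qed
  moreover have "?unique" if "(\<exists>\<alpha>\<in>{0..<1}. ?cvar \<alpha>) \<or> ?linf"
    using that
  proof (elim disjE bexE)
    fix \<alpha> assume \<alpha>: "\<alpha> \<in> {0..<1}" "?cvar \<alpha>"
    show ?unique
      by (rule unique[OF cvar[OF \<alpha>]]) (rule lorentz_eq_CVar[OF _ \<alpha>])
  next
    assume linf': "?linf"
    show ?unique
      by (rule unique[OF linf[OF linf']]) (rule lorentz_eq_decr_rearr_0[OF linf'])
  qed
  ultimately have iff: "?unique \<longleftrightarrow> (\<exists>\<alpha>\<in>{0..<1}. ?cvar \<alpha>) \<or> ?linf"
    by (rule iffI)
  have "?linf \<longrightarrow> ?all (esssup Omega)"
    using linf by (simp add: esssup_eq_decr_rearr_0)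
  moreover have "\<forall>\<alpha>\<in>{0..<1}. ?cvar \<alpha> \<longrightarrow> ?all (CVar \<alpha>)"
    using cvar by blast
  ultimately show ?thesis
    by (intro conjI iff)
qed

end
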